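(* Let $(T^2,J_2)$ be an elliptic curve with a compatible flat metric $g_2$, and let $(T^4,g_4)$ be a flat $4$-torus. Then there is an infinite-dimensional space of complex structures on the $6$-torus $(T^6,g_6)=(T^4\times T^2,\ g_4\oplus g_2)$ which are orthogonal relative to the product metric $g_6$. These structures are of warped product form, determined by a meromorphic function $f:(T^2,J_2)\to\mathbb{P}^1$. When $f$ is non-constant, their lifts to $\mathbb{R}^6$ have infinite energy.
   Context: A complex structure $J$ (integrable almost complex structure) on a Riemannian manifold is orthogonal if it is compatible with (orthogonal with respect to) the metric. Warped product form: OCSes on the flat torus $(T^4,g_4)$ compatible with a fixed orientation that are constant (i.e. lift to constant OCSes on $\mathbb{R}^4$) are parametrized by $\mathrm{SO}(4)/\mathrm{U}(2)=\mathbb{P}^1$. Given a holomorphic map $f:(T^2,J_2)\to\mathbb{P}^1$ (a meromorphic function), the associated structure on $T^4\times T^2$ is $J=J_4\oplus J_2$, where at a point $(u,v)\in T^4\times T^2$, $J_4$ is the constant OCS on $T^4$ corresponding to $f(v)$. Energy: the lift $\tilde J$ of $J$ to the universal cover $\mathbb{R}^6=S^6\setminus\{\infty\}$ is an OCS for the Euclidean metric, hence for the conformally equivalent round metric. It has infinite energy if $\int_{S^6\setminus\{\infty\}}\|\nabla\tilde J\|^6\,dV=\infty$, with covariant derivative, norm and volume form taken with respect to the round metric. *)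

theory Defs
  imports "HOL-Analysis.Analysis"
begin

section \<open>Flat tori and tensor fields on them\<close>

text \<open>
  A flat torus is the quotient of a Euclidean space by a lattice of full rank, and tensor fields on
  it are represented by their lifts: lattice-periodic fields on the universal cover.
\<close>

definition is_lattice :: "'a::euclidean_space set \<Rightarrow> bool" where
  "is_lattice L \<longleftrightarrow> (\<exists>B. independent B \<and> span B = UNIV \<and>
     L = {\<Sum>b\<in>B. of_int (c b) *\<^sub>R b | c. True})"

definition periodic :: "'a::ab_group_add set \<Rightarrow> ('a \<Rightarrow> 'b) \<Rightarrow> bool" where
  "periodic L F \<longleftrightarrow> (\<forall>x. \<forall>l\<in>L. F (x + l) = F x)"

text \<open>
  The index type \<^typ>\<open>4 + 2\<close> is a disjoint sum with six elements, so \<^typ>\<open>real ^ (4 + 2)\<close> is the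
  Euclidean space R^6 with the splitting R^4 x R^2, and R^2 is identified with the complex line by
  \<open>x + i y\<close>.
\<close>

type_synonym R6 = "real ^ (4 + 2)"

definition part4 :: "R6 \<Rightarrow> real ^ 4" where
  "part4 x = (\<chi> i. x $ Inl i)"

definition part2 :: "R6 \<Rightarrow> complex" where
  "part2 x = Complex (x $ Inr 1) (x $ Inr 2)"

definition product_lattice :: "(real ^ 4) set \<Rightarrow> complex set \<Rightarrow> R6 set" where
  "product_lattice L4 L2 = {x. part4 x \<in> L4 \<and> part2 x \<in> L2}"


section \<open>Orthogonal complex structures\<close>

primrec Ck_on :: "nat \<Rightarrow> ('a::real_normed_vector \<Rightarrow> 'b::real_normed_vector) \<Rightarrow> 'a set \<Rightarrow> bool" where
  "Ck_on 0 f S \<longleftrightarrow> continuous_on S f"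
| "Ck_on (Suc k) f S \<longleftrightarrow> (\<forall>x\<in>S. f differentiable (at x)) \<and>
     (\<forall>v. Ck_on k (\<lambda>x. frechet_derivative f (at x) v) S)"

definition smooth_on :: "('a::real_normed_vector \<Rightarrow> 'b::real_normed_vector) \<Rightarrow> 'a set \<Rightarrow> bool" where
  "smooth_on f S \<longleftrightarrow> (\<forall>k. Ck_on k f S)"

text \<open>
  An almost complex structure is integrable if it is induced by an atlas of holomorphic coordinates:
  around every point there is a smooth chart \<open>\<phi>\<close> into C^3 with \<open>d\<phi> \<circ> J = i d\<phi>\<close>.
  (Transition maps between such charts are automatically holomorphic.)
\<close>

definition integrable_acs :: "(R6 \<Rightarrow> real ^ (4 + 2) ^ (4 + 2)) \<Rightarrow> bool" where
  "integrable_acs J \<longleftrightarrow> (\<forall>p. \<exists>U (\<phi> :: R6 \<Rightarrow> complex ^ 3).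
     open U \<and> p \<in> U \<and> smooth_on \<phi> U \<and> inj_on \<phi> U \<and>
     (\<forall>q\<in>U. bij (frechet_derivative \<phi> (at q)) \<and>
        (\<forall>w. frechet_derivative \<phi> (at q) (J q *v w) = \<i> *s frechet_derivative \<phi> (at q) w)))"

text \<open>Complex structures on R^6/L orthogonal with respect to the flat (Euclidean) metric.\<close>

definition torus_ocs :: "R6 set \<Rightarrow> (R6 \<Rightarrow> real ^ (4 + 2) ^ (4 + 2)) \<Rightarrow> bool" where
  "torus_ocs L J \<longleftrightarrow> periodic L J \<and> smooth_on J UNIV \<and>
     (\<forall>x. J x ** J x = - mat 1 \<and> orthogonal_matrix (J x)) \<and> integrable_acs J"


section \<open>The projective line and constant structures on R^4\<close>

datatype P1 = Fin complex | Infty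

definition P1_inverse_chart :: "complex \<Rightarrow> P1" where
  "P1_inverse_chart w = (if w = 0 then Infty else Fin (1 / w))"

definition holomorphic_to_P1 :: "(complex \<Rightarrow> P1) \<Rightarrow> bool" where
  "holomorphic_to_P1 f \<longleftrightarrow> (\<forall>z. \<exists>U h. open U \<and> z \<in> U \<and> h holomorphic_on U \<and>
     ((\<forall>w\<in>U. f w = Fin (h w)) \<or> (\<forall>w\<in>U. f w = P1_inverse_chart (h w))))"

text \<open>Holomorphic maps from the elliptic curve C/L to the projective line.\<close>

definition elliptic_to_P1 :: "complex set \<Rightarrow> (complex \<Rightarrow> P1) set" where
  "elliptic_to_P1 L = {f. holomorphic_to_P1 f \<and> periodic L f}"

text \<open>
  Orthogonal complex structures on the vector space R^4 inducing the standard (\<open>\<sigma> = 1\<close>) or the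
  opposite (\<open>\<sigma> = -1\<close>) orientation, i.e. for which the bases \<open>u, A u, v, A v\<close> have
  orientation \<open>\<sigma>\<close>; this is a copy of SO(4)/U(2).
\<close>

definition linear_ocs4 :: "real \<Rightarrow> (real ^ 4 ^ 4) set" where
  "linear_ocs4 \<sigma> = {A. orthogonal_matrix A \<and> A ** A = - mat 1 \<and>
     (\<forall>u v. 0 \<le> \<sigma> * det (vector [u, A *v u, v, A *v v] :: real ^ 4 ^ 4))}"

text \<open>
  The identification of the projective line with \<^term>\<open>linear_ocs4 \<sigma>\<close>. In the coordinates
  \<open>z1 = x1 + i x2\<close>, \<open>z2 = x3 + i x4\<close> (with \<open>x4\<close> replaced by \<open>- x4\<close> if \<open>\<sigma> = -1\<close>), the structure
  belonging to a finite \<open>f\<close> is the one whose (1,0)-forms are spanned by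
  \<open>dz1 + f d(cnj z2)\<close> and \<open>dz2 - f d(cnj z1)\<close>; explicitly it maps \<open>(z1, z2)\<close> to
  \<open>(i (1 - |f|^2) z1 + 2 i f cnj z2, i (1 - |f|^2) z2 - 2 i f cnj z1) / (1 + |f|^2)\<close>.
  Infinity corresponds to \<open>(z1, z2) \<mapsto> (- i z1, - i z2)\<close>.
\<close>

definition skew4 :: "real \<Rightarrow> real \<Rightarrow> real \<Rightarrow> real ^ 4 ^ 4" where
  "skew4 a b c = vector
     [vector [ 0, -a, -c,  b],
      vector [ a,  0,  b,  c],
      vector [ c, -b,  0, -a],
      vector [-b, -c,  a,  0]]"

definition reflect4 :: "real \<Rightarrow> real ^ 4 ^ 4" where
  "reflect4 \<sigma> = (\<chi> i j. if i = j then (if i = 4 then \<sigma> else 1) else 0)"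

definition sphere_ocs :: "P1 \<Rightarrow> real ^ 4 ^ 4" where
  "sphere_ocs f = (case f of
       Fin w \<Rightarrow> (let s = 1 + (cmod w)\<^sup>2
                 in skew4 ((1 - (cmod w)\<^sup>2) / s) (2 * Re w / s) (2 * Im w / s))
     | Infty \<Rightarrow> skew4 (-1) 0 0)"

definition const_ocs :: "real \<Rightarrow> P1 \<Rightarrow> real ^ 4 ^ 4" where
  "const_ocs \<sigma> f = reflect4 \<sigma> ** sphere_ocs f ** reflect4 \<sigma>"

text \<open>The rest of this section shows that this is indeed a bijection onto \<^term>\<open>linear_ocs4 \<sigma>\<close>.\<close>


lemma vector_4 [simp]:
  "(vector [w, x, y, z] :: ('a::zero) ^ 4) $ 1 = w"
  "(vector [w, x, y, z] :: ('a::zero) ^ 4) $ 2 = x"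
  "(vector [w, x, y, z] :: ('a::zero) ^ 4) $ 3 = y"
  "(vector [w, x, y, z] :: ('a::zero) ^ 4) $ 4 = z"
  unfolding vector_def by simp_all

lemma det_4: "det (A :: 'a::comm_ring_1 ^ 4 ^ 4) =
    A$1$1 * (A$2$2*(A$3$3*A$4$4 - A$3$4*A$4$3) - A$2$3*(A$3$2*A$4$4 - A$3$4*A$4$2) + A$2$4*(A$3$2*A$4$3 - A$3$3*A$4$2))
  - A$1$2 * (A$2$1*(A$3$3*A$4$4 - A$3$4*A$4$3) - A$2$3*(A$3$1*A$4$4 - A$3$4*A$4$1) + A$2$4*(A$3$1*A$4$3 - A$3$3*A$4$1))
  + A$1$3 * (A$2$1*(A$3$2*A$4$4 - A$3$4*A$4$2) - A$2$2*(A$3$1*A$4$4 - A$3$4*A$4$1) + A$2$4*(A$3$1*A$4$2 - A$3$2*A$4$1))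
  - A$1$4 * (A$2$1*(A$3$2*A$4$3 - A$3$3*A$4$2) - A$2$2*(A$3$1*A$4$3 - A$3$3*A$4$1) + A$2$3*(A$3$1*A$4$2 - A$3$2*A$4$1))"
proof -
  have f: "finite {2::4, 3, 4}" "1 \<notin> {2::4, 3, 4}" "finite {3::4, 4}" "2 \<notin> {3::4, 4}" "finite {4::4}" "3 \<notin> {4::4}"
    by auto
  show ?thesis
    unfolding det_def UNIV_4
    unfolding sum_over_permutations_insert[OF f(1,2)]
    unfolding sum_over_permutations_insert[OF f(3,4)]
    unfolding sum_over_permutations_insert[OF f(5,6)]
    unfolding permutes_sing
    by (simp add: sign_swap_id permutation_swap_id sign_compose sign_id permutation_compose swap_id_eq transpose_def algebra_simps)
qed

lemma matrix_mul_minus: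
  fixes A B :: "real ^ 'n ^ 'n"
  shows "(- A) ** B = - (A ** B)" "A ** (- B) = - (A ** B)"
  by (simp_all add: vec_eq_iff matrix_matrix_mult_def sum_negf)

lemma skew4_ocs:
  assumes "a\<^sup>2 + b\<^sup>2 + c\<^sup>2 = 1"
  shows "skew4 a b c \<in> linear_ocs4 1"
proof -
  let ?A = "skew4 a b c"
  have sq: "?A ** ?A = - mat 1"
    using assms
    by (simp add: vec_eq_iff forall_4 matrix_matrix_mult_def sum_4 skew4_def mat_def power2_eq_square)
  have tr: "transpose ?A = - ?A"
    by (simp add: vec_eq_iff forall_4 transpose_def skew4_def)
  have orth: "orthogonal_matrix ?A"
    unfolding orthogonal_matrix tr using sq by (simp add: matrix_mul_minus)
  have "0 \<le> det (vector [u, ?A *v u, v, ?A *v v] :: real ^ 4 ^ 4)" for u v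
  proof -
    have d: "det (vector [u, ?A *v u, v, ?A *v v] :: real ^ 4 ^ 4) =
      (a\<^sup>2 + b\<^sup>2 + c\<^sup>2) * ((u \<bullet> u) * (v \<bullet> v) - (u \<bullet> v)\<^sup>2) - (u \<bullet> (?A *v v))\<^sup>2"
      by (simp add: det_4 skew4_def matrix_vector_mult_def sum_4 inner_vec_def power2_eq_square algebra_simps)
    have vAv: "v \<bullet> (?A *v v) = 0"
      by (simp add: skew4_def matrix_vector_mult_def sum_4 inner_vec_def algebra_simps)
    have AvAv: "(?A *v v) \<bullet> (?A *v v) = v \<bullet> v"
      using orth by (metis orthogonal_transformation_matrix orthogonal_transformation_def matrix_of_matrix_vector_mul matrix_vector_mul_linear)
    define w where "w = (v \<bullet> v) *\<^sub>R u - (u \<bullet> v) *\<^sub>R v - (u \<bullet> (?A *v v)) *\<^sub>R (?A *v v)"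
    have "w \<bullet> w = (v \<bullet> v) * ((u \<bullet> u) * (v \<bullet> v) - (u \<bullet> v)\<^sup>2 - (u \<bullet> (?A *v v))\<^sup>2)"
      unfolding w_def inner_diff_left inner_diff_right inner_scaleR_left inner_scaleR_right
        AvAv vAv inner_commute[of "?A *v v" v] inner_commute[of v u] inner_commute[of "?A *v v" u]
      by (simp add: power2_eq_square algebra_simps)
    then have "0 \<le> (v \<bullet> v) * ((u \<bullet> u) * (v \<bullet> v) - (u \<bullet> v)\<^sup>2 - (u \<bullet> (?A *v v))\<^sup>2)"
      by (metis inner_ge_zero)
    then show ?thesis
      unfolding d assms
      by (cases "v = 0") (auto simp: zero_le_mult_iff dest: order_antisym[OF _ inner_ge_zero])
  qed
  with sq orth show ?thesis by (simp add: linear_ocs4_def)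
qed

lemma linear_ocs4_skew4:
  assumes "A \<in> linear_ocs4 1"
  obtains a b c where "a\<^sup>2 + b\<^sup>2 + c\<^sup>2 = 1" "A = skew4 a b c"
proof -
  have orth: "orthogonal_matrix A" and sq: "A ** A = - mat 1"
    and pos: "\<And>u v. 0 \<le> det (vector [u, A *v u, v, A *v v] :: real ^ 4 ^ 4)"
    using assms by (auto simp: linear_ocs4_def)
  have "transpose A = transpose A ** (- (A ** A))"
    by (simp add: sq)
  also have "\<dots> = - ((transpose A ** A) ** A)"
    by (simp add: matrix_mul_assoc matrix_mul_minus)
  finally have tr: "transpose A = - A"
    using orth by (simp add: orthogonal_matrix)
  have sk: "A $ j $ i = - A $ i $ j" for i j
    using arg_cong[OF tr, of "\<lambda>M. M $ i $ j"]
    by (simp only: transpose_def vec_lambda_beta vector_uminus_component)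
  have diag: "A $ i $ i = 0" for i
    using sk[of i i] by linarith
  define x y z X Y Z where defs: "x = A$2$1" "y = A$3$1" "z = A$4$1" "X = A$4$3" "Y = A$4$2" "Z = A$3$2"
  have ent: "A$1$1 = 0" "A$2$2 = 0" "A$3$3 = 0" "A$4$4 = 0"
    "A$2$1 = x" "A$3$1 = y" "A$4$1 = z" "A$4$3 = X" "A$4$2 = Y" "A$3$2 = Z"
    "A$1$2 = -x" "A$1$3 = -y" "A$1$4 = -z" "A$3$4 = -X" "A$2$4 = -Y" "A$2$3 = -Z"
    using sk[of 1 2] sk[of 1 3] sk[of 1 4] sk[of 3 4] sk[of 2 4] sk[of 2 3]
    by (simp_all add: defs diag)
  have eqs: "x*x + y*y + z*z = 1" "x*x + Z*Z + Y*Y = 1" "y*y + Z*Z + X*X = 1" "z*z + Y*Y + X*X = 1"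
     "y*Z + z*Y = 0" "x*Z - z*X = 0" "x*Y + y*X = 0"
    using sq by (simp_all add: vec_eq_iff forall_4 matrix_matrix_mult_def sum_4 mat_def ent)
  have p1: "0 \<le> x * X + z * Z"
    using pos[of "axis 1 1" "axis 3 1"]
    by (simp add: det_4 matrix_vector_mult_def sum_4 axis_def ent)
  have p2: "0 \<le> z * Z - y * Y"
    using pos[of "axis 1 1" "axis 2 1"]
    by (simp add: det_4 matrix_vector_mult_def sum_4 axis_def ent)
  have p3: "0 \<le> x * X - y * Y"
    using pos[of "axis 1 1" "axis 4 1"]
    by (simp add: det_4 matrix_vector_mult_def sum_4 axis_def ent)
  define t where "t = x * X - y * Y + z * Z"
  have t: "0 \<le> t" using p1 p2 p3 by (simp add: t_def)
  have "X = t * x" "Y = - t * y" "Z = t * z"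
    using eqs unfolding t_def by algebra+
  moreover have "t * t = 1"
    using eqs calculation by algebra
  then have "t = 1" using t by (metis abs_of_nonneg power2_eq_1_iff power2_eq_square abs_minus_cancel abs_one)
  ultimately have "A = skew4 x (-z) y"
    by (simp add: vec_eq_iff forall_4 skew4_def ent)
  with eqs(1) that[of x "-z" y] show ?thesis by (simp add: power2_eq_square)
qed


lemma skew4_inject: "skew4 a b c = skew4 a' b' c' \<longleftrightarrow> a = a' \<and> b = b' \<and> c = c'"
  by (auto simp: vec_eq_iff forall_4 skew4_def)

lemma one_plus_norm_pos: "1 + (cmod w)\<^sup>2 > 0"
  by (simp add: add_pos_nonneg)

lemma inj_sphere_ocs: "inj sphere_ocs"
proof (rule injI)
  have fin: "(1 - (cmod w)\<^sup>2) / (1 + (cmod w)\<^sup>2) = 2 / (1 + (cmod w)\<^sup>2) - 1" for w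
    using one_plus_norm_pos[of w] by (simp add: field_simps)
  have ne: "2 / (1 + (cmod w)\<^sup>2) > 0" for w
    using one_plus_norm_pos[of w] by simp
  fix f g assume eq: "sphere_ocs f = sphere_ocs g"
  show "f = g"
  proof (cases f; cases g)
    fix v w assume fg: "f = Fin v" "g = Fin w"
    then have "2 / (1 + (cmod v)\<^sup>2) = 2 / (1 + (cmod w)\<^sup>2)"
      and *: "2 * Re v / (1 + (cmod v)\<^sup>2) = 2 * Re w / (1 + (cmod w)\<^sup>2)"
        "2 * Im v / (1 + (cmod v)\<^sup>2) = 2 * Im w / (1 + (cmod w)\<^sup>2)"
      using eq by (auto simp: sphere_ocs_def Let_def skew4_inject fin)
    then have "1 + (cmod v)\<^sup>2 = 1 + (cmod w)\<^sup>2"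
      using one_plus_norm_pos[of w] one_plus_norm_pos[of v] by (simp add: field_simps)
    with * one_plus_norm_pos[of w] have "Re v = Re w" "Im v = Im w"
      by (simp_all add: complex_eq_iff)
    with fg show ?thesis by (simp add: complex_eq_iff)
  next
    fix w assume "f = Fin w" "g = Infty"
    then show ?thesis using eq ne[of w] by (auto simp: sphere_ocs_def Let_def skew4_inject fin)
  next
    fix w assume "f = Infty" "g = Fin w"
    then show ?thesis using eq ne[of w] by (auto simp: sphere_ocs_def Let_def skew4_inject fin)
  qed auto
qed

lemma range_sphere_ocs: "range sphere_ocs = linear_ocs4 1"
proof (intro subset_antisym subsetI)
  fix A assume "A \<in> range sphere_ocs"
  then obtain f where A: "A = sphere_ocs f" by auto
  show "A \<in> linear_ocs4 1"
  proof (cases f)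
    case Infty
    then show ?thesis using A skew4_ocs[of "-1" 0 0] by (simp add: sphere_ocs_def)
  next
    case (Fin w)
    define s where "s = 1 + (cmod w)\<^sup>2"
    have s: "s > 0" using one_plus_norm_pos[of w] by (simp add: s_def)
    have n: "(cmod w)\<^sup>2 = s - 1" "(Re w)\<^sup>2 + (Im w)\<^sup>2 = s - 1" by (simp_all add: s_def cmod_power2)
    have "(1 - (cmod w)\<^sup>2)\<^sup>2 + (2 * Re w)\<^sup>2 + (2 * Im w)\<^sup>2 = (2 - s)\<^sup>2 + 4 * ((Re w)\<^sup>2 + (Im w)\<^sup>2)"
      by (simp add: n(1) power_mult_distrib)
    also have "\<dots> = s\<^sup>2"
      unfolding n(2) by (simp add: power2_eq_square algebra_simps)
    finally have "((1 - (cmod w)\<^sup>2) / s)\<^sup>2 + (2 * Re w / s)\<^sup>2 + (2 * Im w / s)\<^sup>2 = 1"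
      using s by (simp add: power_divide flip: add_divide_distrib)
    then show ?thesis
      using A Fin skew4_ocs by (simp add: sphere_ocs_def Let_def s_def)
  qed
next
  fix A assume "A \<in> linear_ocs4 1"
  then obtain a b c where abc: "a\<^sup>2 + b\<^sup>2 + c\<^sup>2 = 1" "A = skew4 a b c"
    by (rule linear_ocs4_skew4)
  show "A \<in> range sphere_ocs"
  proof (cases "a = -1")
    case True
    with abc have "b = 0" "c = 0" by (simp_all add: sum_power2_eq_zero_iff)
    then have "A = sphere_ocs Infty" using abc True by (simp add: sphere_ocs_def)
    then show ?thesis by blast
  next
    case False
    define w where "w = Complex (b / (1 + a)) (c / (1 + a))"
    have a1: "1 + a \<noteq> 0" using False by linarith
    have bc: "b\<^sup>2 + c\<^sup>2 = (1 + a) * (1 - a)"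
      using abc by (simp add: power2_eq_square algebra_simps)
    have "(cmod w)\<^sup>2 = (b\<^sup>2 + c\<^sup>2) / (1 + a)\<^sup>2"
      by (simp add: cmod_power2 w_def power_divide add_divide_distrib)
    also have "\<dots> = (1 - a) / (1 + a)"
      unfolding bc using a1 by (simp add: power2_eq_square)
    finally have n: "(cmod w)\<^sup>2 = (1 - a) / (1 + a)" .
    have s: "1 + (cmod w)\<^sup>2 = 2 / (1 + a)" "1 - (cmod w)\<^sup>2 = 2 * a / (1 + a)"
      using a1 by (simp_all add: n field_simps)
    have "A = sphere_ocs (Fin w)"
      unfolding sphere_ocs_def Let_def s P1.case abc(2) skew4_inject
      using a1 by (simp add: w_def)
    then show ?thesis by blast
  qed
qed

lemma reflect4_conj:
  assumes \<sigma>: "\<sigma> = 1 \<or> \<sigma> = -1" and A: "A \<in> linear_ocs4 \<tau>"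
  shows "reflect4 \<sigma> ** A ** reflect4 \<sigma> \<in> linear_ocs4 (\<tau> * \<sigma>)"
proof -
  let ?R = "reflect4 \<sigma>" and ?B = "reflect4 \<sigma> ** A ** reflect4 \<sigma>"
  have RR: "?R ** ?R = mat 1"
    using \<sigma> by (auto simp: vec_eq_iff forall_4 matrix_matrix_mult_def sum_4 reflect4_def mat_def)
  have Rt: "transpose ?R = ?R"
    by (simp add: vec_eq_iff forall_4 transpose_def reflect4_def)
  have RRX: "?R ** (?R ** X) = X" for X
    by (simp add: matrix_mul_assoc RR)
  have orth: "orthogonal_matrix A" and sq: "A ** A = - mat 1"
    and pos: "\<And>u v. 0 \<le> \<tau> * det (vector [u, A *v u, v, A *v v] :: real ^ 4 ^ 4)"
    using A by (auto simp: linear_ocs4_def)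
  have "orthogonal_matrix ?R" by (simp add: orthogonal_matrix Rt RR)
  then have 1: "orthogonal_matrix ?B"
    using orth by (intro orthogonal_matrix_mul)
  have "?B ** ?B = ?R ** (A ** A) ** ?R"
    by (simp add: RRX flip: matrix_mul_assoc)
  also have "\<dots> = - mat 1"
    by (simp add: sq matrix_mul_minus RR)
  finally have 2: "?B ** ?B = - mat 1" .
  have "0 \<le> \<tau> * \<sigma> * det (vector [u, ?B *v u, v, ?B *v v] :: real ^ 4 ^ 4)" for u v
  proof -
    define u' v' where uv: "u' = ?R *v u" "v' = ?R *v v"
    have uv': "u = ?R *v u'" "v = ?R *v v'" by (simp_all add: uv matrix_vector_mul_assoc RR)
    have B: "?B *v u = ?R *v (A *v u')" "?B *v v = ?R *v (A *v v')"
      by (simp_all add: uv matrix_vector_mul_assoc matrix_mul_assoc)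
    have "vector [u, ?B *v u, v, ?B *v v] = (vector [u', A *v u', v', A *v v'] :: real ^ 4 ^ 4) ** ?R"
      unfolding B unfolding uv'
      by (simp add: vec_eq_iff forall_4 matrix_matrix_mult_def matrix_vector_mult_def sum_4 reflect4_def)
    then have "det (vector [u, ?B *v u, v, ?B *v v] :: real ^ 4 ^ 4) =
        det (vector [u', A *v u', v', A *v v'] :: real ^ 4 ^ 4) * \<sigma>"
      by (simp add: det_mul) (simp add: det_4 reflect4_def)
    then show ?thesis using pos[of u' v'] \<sigma> by auto
  qed
  with 1 2 show ?thesis by (simp add: linear_ocs4_def)
qed

lemma bij_betw_const_ocs:
  assumes \<sigma>: "\<sigma> = 1 \<or> \<sigma> = -1"
  shows "bij_betw (const_ocs \<sigma>) UNIV (linear_ocs4 \<sigma>)"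
proof -
  let ?R = "reflect4 \<sigma>"
  have c: "const_ocs \<sigma> f = ?R ** sphere_ocs f ** ?R" for f
    by (simp add: const_ocs_def)
  have RR: "?R ** ?R = mat 1"
    using \<sigma> by (auto simp: vec_eq_iff forall_4 matrix_matrix_mult_def sum_4 reflect4_def mat_def)
  have RRX: "?R ** (?R ** X) = X" for X
    by (simp add: matrix_mul_assoc RR)
  have inv: "?R ** (?R ** X ** ?R) ** ?R = X" for X
    by (simp add: RRX RR flip: matrix_mul_assoc)
  have "inj (const_ocs \<sigma>)"
    by (metis (no_types, lifting) c inj_def inj_sphere_ocs inv)
  moreover have "const_ocs \<sigma> f \<in> linear_ocs4 \<sigma>" for f
    unfolding c using reflect4_conj[OF \<sigma>, of "sphere_ocs f" 1] range_sphere_ocs by auto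
  moreover have "A \<in> range (const_ocs \<sigma>)" if "A \<in> linear_ocs4 \<sigma>" for A
  proof -
    have "?R ** A ** ?R \<in> linear_ocs4 1"
      using reflect4_conj[OF \<sigma> that] \<sigma> by auto
    then obtain f where "?R ** A ** ?R = sphere_ocs f"
      using range_sphere_ocs by (metis imageE)
    then have "A = const_ocs \<sigma> f" unfolding c by (metis inv)
    then show ?thesis by blast
  qed
  ultimately show ?thesis by (auto simp: bij_betw_def)
qed


section \<open>Warped products\<close>

definition J2_std :: "real ^ 2 ^ 2" where
  "J2_std = vector [vector [0, -1], vector [1, 0]]"

definition block_sum :: "real ^ 4 ^ 4 \<Rightarrow> real ^ 2 ^ 2 \<Rightarrow> real ^ (4 + 2) ^ (4 + 2)" where
  "block_sum A B = (\<chi> i j. case (i, j) of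
       (Inl a, Inl b) \<Rightarrow> A $ a $ b
     | (Inr a, Inr b) \<Rightarrow> B $ a $ b
     | _ \<Rightarrow> 0)"

definition warped :: "real \<Rightarrow> (complex \<Rightarrow> P1) \<Rightarrow> R6 \<Rightarrow> real ^ (4 + 2) ^ (4 + 2)" where
  "warped \<sigma> f x = block_sum (const_ocs \<sigma> (f (part2 x))) J2_std"


section \<open>Infinite-dimensional spaces of structures\<close>

text \<open>
  A set \<open>S\<close> of fields is given the topology of uniform convergence (via the type of bounded
  continuous functions), and a topological space is called infinite-dimensional if it contains
  a homeomorphic copy of R^n for every n.
\<close>

definition uniform_topology ::
  "('a::topological_space \<Rightarrow> 'b::metric_space) set \<Rightarrow> ('a \<Rightarrow>\<^sub>C 'b) topology" where
  "uniform_topology S = top_of_set {T. apply_bcontfun T \<in> S}"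

definition infinite_dimensional :: "'a topology \<Rightarrow> bool" where
  "infinite_dimensional X \<longleftrightarrow> (\<forall>n. \<exists>h. embedding_map (Euclidean_space n) X h)"


section \<open>Energy with respect to the round metric\<close>

definition pderiv_at :: "'n \<Rightarrow> (real ^ 'n \<Rightarrow> real) \<Rightarrow> real ^ 'n \<Rightarrow> real" where
  "pderiv_at i F x = frechet_derivative F (at x) (axis i 1)"

text \<open>The Christoffel symbol \<open>\<Gamma>^k_ij\<close> of a Riemannian metric \<open>g\<close>.\<close>

definition christoffel :: "(real ^ 'n \<Rightarrow> real ^ 'n ^ 'n) \<Rightarrow> 'n \<Rightarrow> 'n \<Rightarrow> 'n \<Rightarrow> real ^ 'n \<Rightarrow> real" where
  "christoffel g k i j x = 1 / 2 * (\<Sum>l\<in>UNIV. matrix_inv (g x) $ k $ l *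
     (pderiv_at i (\<lambda>y. g y $ j $ l) x + pderiv_at j (\<lambda>y. g y $ i $ l) x
      - pderiv_at l (\<lambda>y. g y $ i $ j) x))"

text \<open>The component \<open>\<nabla>_i J^k_j\<close>, where \<open>J^k_j\<close> is the matrix entry in row \<open>k\<close> and column \<open>j\<close>.\<close>

definition cov_deriv ::
  "(real ^ 'n \<Rightarrow> real ^ 'n ^ 'n) \<Rightarrow> (real ^ 'n \<Rightarrow> real ^ 'n ^ 'n) \<Rightarrow> 'n \<Rightarrow> 'n \<Rightarrow> 'n \<Rightarrow> real ^ 'n \<Rightarrow> real"
where
  "cov_deriv g J i k j x = pderiv_at i (\<lambda>y. J y $ k $ j) x
     + (\<Sum>l\<in>UNIV. christoffel g k i l x * J x $ l $ j)
     - (\<Sum>l\<in>UNIV. christoffel g l i j x * J x $ k $ l)"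

definition norm_cov_deriv ::
  "(real ^ 'n \<Rightarrow> real ^ 'n ^ 'n) \<Rightarrow> (real ^ 'n \<Rightarrow> real ^ 'n ^ 'n) \<Rightarrow> real ^ 'n \<Rightarrow> real" where
  "norm_cov_deriv g J x = sqrt (\<Sum>i\<in>UNIV. \<Sum>i'\<in>UNIV. \<Sum>j\<in>UNIV. \<Sum>j'\<in>UNIV. \<Sum>k\<in>UNIV. \<Sum>k'\<in>UNIV.
     matrix_inv (g x) $ i $ i' * matrix_inv (g x) $ j $ j' * g x $ k $ k' *
     cov_deriv g J i k j x * cov_deriv g J i' k' j' x)"

text \<open>
  Inverse stereographic projection onto the unit sphere of \<open>R^n \<times> R\<close> minus the north pole, and the
  round metric in the resulting coordinates, i.e. the pullback of the Euclidean metric.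
\<close>

definition inv_stereographic :: "real ^ 'n \<Rightarrow> (real ^ 'n) \<times> real" where
  "inv_stereographic x =
     ((2 / (1 + (norm x)\<^sup>2)) *\<^sub>R x, ((norm x)\<^sup>2 - 1) / (1 + (norm x)\<^sup>2))"

definition round_metric :: "real ^ 'n \<Rightarrow> real ^ 'n ^ 'n" where
  "round_metric x = (\<chi> i j.
     frechet_derivative inv_stereographic (at x) (axis i 1) \<bullet>
     frechet_derivative inv_stereographic (at x) (axis j 1))"

definition energy :: "(R6 \<Rightarrow> real ^ (4 + 2) ^ (4 + 2)) \<Rightarrow> ennreal" where
  "energy J = (\<integral>\<^sup>+ x. ennreal (norm_cov_deriv round_metric J x ^ 6 * sqrt (det (round_metric x)))
     \<partial>lborel)"

end

theory Submission
  imports Defs "HOL-Complex_Analysis.Complex_Analysis"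
begin

text \<open>
  Integrability: if \<open>f = [\<alpha> : \<beta>]\<close> with \<open>\<alpha>\<close>, \<open>\<beta>\<close> holomorphic functions of \<open>z\<close>, the (1,0)-forms of the warped
  structure are spanned by \<open>\<alpha> dz1 + \<beta> d(cnj z2)\<close>, \<open>\<alpha> dz2 - \<beta> d(cnj z1)\<close> and \<open>dz\<close>, hence also by the
  differentials of \<open>\<alpha> z1 + \<beta> cnj z2\<close>, \<open>\<alpha> z2 - \<beta> cnj z1\<close> and \<open>z\<close>, which are therefore holomorphic
  coordinates.

  Energy: the energy is conformally invariant up to lower order terms, and these vanish for
  the components \<open>\<nabla>_i J^k_j\<close> with \<open>i\<close> along \<open>T^2\<close> and \<open>j\<close>, \<open>k\<close> along \<open>T^4\<close>. The remaining integrand does not depend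
  on the \<open>R^4\<close> coordinates, so its integral is infinite unless it vanishes identically.

  Infinite dimension: composing the elliptic function \<open>\<Sum> 1 / (z - \<omega>)^4\<close> with polynomials having a fixed leading term and
  prescribed values \<open>c_1, \<dots>, c_n\<close> at \<open>n\<close> of its values gives an embedding of \<open>R^n\<close>: the dependence on
  \<open>c\<close> is uniform in the chordal metric because of the leading term, and \<open>c\<close> is recovered by
  evaluation at \<open>n\<close> points.
\<close>

no_notation fps_nth (infixl "$" 75)


section \<open>Smoothness and integrability\<close>

lemma Ck_on_cong:
  assumes "open S" "\<And>x. x \<in> S \<Longrightarrow> f x = g x" "Ck_on k f S"
  shows "Ck_on k g S"
  using assms(2,3)
proof (induction k arbitrary: f g)
  case 0
  then show ?case by (simp cong: continuous_on_cong)
next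
  case (Suc k)
  have d: "f differentiable (at x)" if "x \<in> S" for x using Suc.prems that by simp
  have eq: "frechet_derivative f (at x) = frechet_derivative g (at x)" if "x \<in> S" for x
    by (rule frechet_derivative_transform_within_open[OF d[OF that] \<open>open S\<close> that Suc.prems(1)])
  have "g differentiable (at x)" if "x \<in> S" for x
    using d[OF that] has_derivative_transform_within_open[of f _ x UNIV S g] \<open>open S\<close> that Suc.prems(1)
    by (auto simp: differentiable_def)
  moreover have "Ck_on k (\<lambda>x. frechet_derivative g (at x) v) S" for v
  proof (rule Suc.IH)
    show "Ck_on k (\<lambda>x. frechet_derivative f (at x) v) S" using Suc.prems(2) by simp
  qed (simp add: eq)
  ultimately show ?case by simp
qed

lemma Ck_on_local:
  assumes "\<And>x. x \<in> S \<Longrightarrow> \<exists>U. open U \<and> x \<in> U \<and> Ck_on k f U"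
  shows "Ck_on k f S"
  using assms
proof (induction k arbitrary: f)
  case 0
  then have "continuous (at x) f" if "x \<in> S" for x
    using that by (metis Ck_on.simps(1) continuous_on_eq_continuous_at)
  then show ?case by (simp add: continuous_at_imp_continuous_on)
next
  case (Suc k)
  then have "f differentiable (at x)" if "x \<in> S" for x
    using that by (metis Ck_on.simps(2))
  moreover have "Ck_on k (\<lambda>x. frechet_derivative f (at x) v) S" for v
    using Suc.prems by (intro Suc.IH) (metis Ck_on.simps(2))
  ultimately show ?case by simp
qed

lemma smooth_on_local:
  assumes "\<And>x. x \<in> S \<Longrightarrow> \<exists>U. open U \<and> x \<in> U \<and> smooth_on f U"
  shows "smooth_on f S"
  using assms unfolding smooth_on_def by (metis Ck_on_local)

text \<open>\<open>Ck_on\<close> recurses through directional derivatives, so a family that contains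
  the directional derivatives of its members lies in \<open>Ck_on k\<close> for every
  \<open>k\<close>, by induction. The derivative enters as an explicit \<open>D\<close>, which
  spares computing \<open>frechet_derivative\<close>; openness of \<open>S\<close> lets
  \<open>Ck_on_cong\<close> exchange the two.\<close>

lemma smooth_on_coinduct:
  fixes F :: "('a::real_normed_vector \<Rightarrow> 'b::real_normed_vector) set"
  assumes "open S" "f \<in> F"
    and step: "\<And>g. g \<in> F \<Longrightarrow> \<exists>D. (\<forall>x\<in>S. (g has_derivative D x) (at x)) \<and> (\<forall>v. (\<lambda>x. D x v) \<in> F)"
  shows "smooth_on f S"
proof -
  have "Ck_on k f S" for k
    using \<open>f \<in> F\<close>
  proof (induction k arbitrary: f)
    case 0
    then obtain D where "\<forall>x\<in>S. (f has_derivative D x) (at x)" using step by blast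
    then show ?case
      by (auto intro!: continuous_at_imp_continuous_on has_derivative_continuous)
  next
    case (Suc k)
    then obtain D where D: "\<forall>x\<in>S. (f has_derivative D x) (at x)" "\<forall>v. (\<lambda>x. D x v) \<in> F"
      using step by blast
    have "Ck_on k (\<lambda>x. frechet_derivative f (at x) v) S" for v
    proof (rule Ck_on_cong[OF \<open>open S\<close>])
      show "Ck_on k (\<lambda>x. D x v) S" using D(2) Suc.IH by blast
      show "D x v = frechet_derivative f (at x) v" if "x \<in> S" for x
        using D(1) that by (metis frechet_derivative_at)
    qed
    then show ?case using D(1) by (auto simp: differentiable_def)
  qed
  then show ?thesis by (simp add: smooth_on_def)
qed

text \<open>A class of real functions closed under directional derivatives, so that its members are smooth.\<close>

inductive_set smooth_class :: "complex set \<Rightarrow> (R6 \<Rightarrow> real) set" for U where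
  const: "(\<lambda>_. c) \<in> smooth_class U"
| coord: "(\<lambda>x. x $ i) \<in> smooth_class U"
| Re_hol: "h holomorphic_on U \<Longrightarrow> (\<lambda>x. Re (h (part2 x))) \<in> smooth_class U"
| Im_hol: "h holomorphic_on U \<Longrightarrow> (\<lambda>x. Im (h (part2 x))) \<in> smooth_class U"
| add: "f \<in> smooth_class U \<Longrightarrow> g \<in> smooth_class U \<Longrightarrow> (\<lambda>x. f x + g x) \<in> smooth_class U"
| mult: "f \<in> smooth_class U \<Longrightarrow> g \<in> smooth_class U \<Longrightarrow> (\<lambda>x. f x * g x) \<in> smooth_class U"
| inverse: "f \<in> smooth_class U \<Longrightarrow> (\<And>x. part2 x \<in> U \<Longrightarrow> f x \<noteq> 0) \<Longrightarrow> (\<lambda>x. inverse (f x)) \<in> smooth_class U"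

lemma smooth_class_minus: "f \<in> smooth_class U \<Longrightarrow> (\<lambda>x. - f x) \<in> smooth_class U"
  using smooth_class.mult[OF smooth_class.const[of "-1"]] by fastforce

lemma smooth_class_diff: "f \<in> smooth_class U \<Longrightarrow> g \<in> smooth_class U \<Longrightarrow> (\<lambda>x. f x - g x) \<in> smooth_class U"
  using smooth_class.add[OF _ smooth_class_minus] by fastforce

section \<open>Differentiating functions of the elliptic coordinate\<close>

lemma part2_alt: "part2 x = of_real (x $ Inr 1) + \<i> * of_real (x $ Inr 2)"
  by (simp add: part2_def complex_eq_iff)

lemma part2_add: "part2 (x + y) = part2 x + part2 y"
  by (simp add: part2_def complex_eq_iff)

lemma has_derivative_part2 [derivative_intros]:
  "(g has_derivative g') F \<Longrightarrow> ((\<lambda>x. part2 (g x)) has_derivative (\<lambda>x. part2 (g' x))) F"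
  unfolding part2_alt
  by (auto intro!: derivative_eq_intros bounded_linear.has_derivative[OF bounded_linear_vec_nth])

lemma continuous_part2 [continuous_intros]:
  "continuous_on S g \<Longrightarrow> continuous_on S (\<lambda>x. part2 (g x))"
  unfolding part2_alt by (auto intro!: continuous_intros)

lemma open_part2_vimage: "open U \<Longrightarrow> open (part2 -` U)"
  by (intro open_vimage continuous_intros)

lemma has_derivative_hol_part2:
  assumes "h holomorphic_on U" "open U" "part2 x \<in> U"
  shows "((\<lambda>x. h (part2 x)) has_derivative (\<lambda>v. deriv h (part2 x) * part2 v)) (at x)"
proof -
  have "(h has_field_derivative deriv h (part2 x)) (at (part2 x))"
    using assms holomorphic_derivI by blast
  then have "(h has_derivative (*) (deriv h (part2 x))) (at (part2 x))"
    by (simp add: has_field_derivative_def)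
  from has_derivative_compose[OF has_derivative_part2[OF has_derivative_ident] this]
  show ?thesis .
qed

text \<open>For fixed \<open>v\<close> the function \<open>deriv h z * part2 v\<close> is again
  holomorphic in \<open>z\<close>, so real and imaginary parts stay in the class; the product rule
  and the rule for inverses keep the other generators inside.\<close>

lemma smooth_class_derivative:
  assumes "f \<in> smooth_class U" "open U"
  shows "\<exists>D. (\<forall>x\<in>part2 -` U. (f has_derivative D x) (at x)) \<and> (\<forall>v. (\<lambda>x. D x v) \<in> smooth_class U)"
  using assms(1)
proof induction
  case (const c)
  show ?case
    by (rule exI[of _ "\<lambda>_ _. 0"]) (auto intro: smooth_class.const)
next
  case (coord i)
  show ?case
    by (rule exI[of _ "\<lambda>_ v. v $ i"])
      (auto intro: smooth_class.const bounded_linear_imp_has_derivative bounded_linear_vec_nth)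
next
  case (Re_hol h)
  have h': "deriv h holomorphic_on U" using Re_hol \<open>open U\<close> holomorphic_deriv by blast
  show ?case
  proof (rule exI[of _ "\<lambda>x v. Re (deriv h (part2 x) * part2 v)"], intro conjI ballI allI)
    show "((\<lambda>x. Re (h (part2 x))) has_derivative (\<lambda>v. Re (deriv h (part2 x) * part2 v))) (at x)"
      if "x \<in> part2 -` U" for x
      using that by (intro has_derivative_Re has_derivative_hol_part2[OF Re_hol \<open>open U\<close>]) auto
    show "(\<lambda>x. Re (deriv h (part2 x) * part2 v)) \<in> smooth_class U" for v
      by (intro smooth_class.Re_hol[of "\<lambda>z. deriv h z * part2 v"] holomorphic_intros h')
  qed
next
  case (Im_hol h)
  have h': "deriv h holomorphic_on U" using Im_hol \<open>open U\<close> holomorphic_deriv by blast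
  show ?case
  proof (rule exI[of _ "\<lambda>x v. Im (deriv h (part2 x) * part2 v)"], intro conjI ballI allI)
    show "((\<lambda>x. Im (h (part2 x))) has_derivative (\<lambda>v. Im (deriv h (part2 x) * part2 v))) (at x)"
      if "x \<in> part2 -` U" for x
      using that by (intro has_derivative_Im has_derivative_hol_part2[OF Im_hol \<open>open U\<close>]) auto
    show "(\<lambda>x. Im (deriv h (part2 x) * part2 v)) \<in> smooth_class U" for v
      by (intro smooth_class.Im_hol[of "\<lambda>z. deriv h z * part2 v"] holomorphic_intros h')
  qed
next
  case (add f g)
  then obtain D E where
    "\<forall>x\<in>part2 -` U. (f has_derivative D x) (at x)" "\<And>v. (\<lambda>x. D x v) \<in> smooth_class U"
    "\<forall>x\<in>part2 -` U. (g has_derivative E x) (at x)" "\<And>v. (\<lambda>x. E x v) \<in> smooth_class U"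
    by blast
  then show ?case
    by (intro exI[of _ "\<lambda>x v. D x v + E x v"])
      (auto intro!: smooth_class.add derivative_intros)
next
  case (mult f g)
  then obtain D E where
    "\<forall>x\<in>part2 -` U. (f has_derivative D x) (at x)" "\<And>v. (\<lambda>x. D x v) \<in> smooth_class U"
    "\<forall>x\<in>part2 -` U. (g has_derivative E x) (at x)" "\<And>v. (\<lambda>x. E x v) \<in> smooth_class U"
    by blast
  with mult.hyps show ?case
    by (intro exI[of _ "\<lambda>x v. f x * E x v + D x v * g x"])
      (auto intro!: smooth_class.add smooth_class.mult has_derivative_mult)
next
  case (inverse f)
  then obtain D where
    "\<forall>x\<in>part2 -` U. (f has_derivative D x) (at x)" "\<And>v. (\<lambda>x. D x v) \<in> smooth_class U"
    by blast
  with inverse.hyps show ?case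
    by (intro exI[of _ "\<lambda>x v. - (inverse (f x) * D x v * inverse (f x))"])
      (auto intro!: smooth_class_minus smooth_class.mult smooth_class.inverse has_derivative_inverse)
qed

text \<open>The maps all of whose coordinates lie in \<open>smooth_class U\<close> form a family as
  required by \<open>smooth_on_coinduct\<close>; the derivatives of the coordinates are assembled
  into one derivative.\<close>

lemma smooth_class_imp_smooth_on:
  fixes f :: "R6 \<Rightarrow> 'b::euclidean_space"
  assumes "open U" "\<And>b. b \<in> Basis \<Longrightarrow> (\<lambda>x. f x \<bullet> b) \<in> smooth_class U"
  shows "smooth_on f (part2 -` U)"
proof (rule smooth_on_coinduct)
  let ?F = "{g :: R6 \<Rightarrow> 'b. \<forall>b\<in>Basis. (\<lambda>x. g x \<bullet> b) \<in> smooth_class U}"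
  show "open (part2 -` U)" using \<open>open U\<close> by (rule open_part2_vimage)
  show "f \<in> ?F" using assms by simp
  fix g assume "g \<in> ?F"
  then have "\<forall>b\<in>Basis. \<exists>D. (\<forall>x\<in>part2 -` U. ((\<lambda>x. g x \<bullet> b) has_derivative D x) (at x)) \<and> (\<forall>v. (\<lambda>x. D x v) \<in> smooth_class U)"
    using smooth_class_derivative[OF _ \<open>open U\<close>] by blast
  from bchoice[OF this] obtain D where D': "\<forall>b\<in>Basis.
      (\<forall>x\<in>part2 -` U. ((\<lambda>x. g x \<bullet> b) has_derivative D b x) (at x)) \<and> (\<forall>v. (\<lambda>x. D b x v) \<in> smooth_class U)"
    by (rule exE)
  then have D: "\<And>b x. b \<in> Basis \<Longrightarrow> part2 x \<in> U \<Longrightarrow> ((\<lambda>x. g x \<bullet> b) has_derivative D b x) (at x)"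
    "\<And>b v. b \<in> Basis \<Longrightarrow> (\<lambda>x. D b x v) \<in> smooth_class U"
    by simp_all
  show "\<exists>D. (\<forall>x\<in>part2 -` U. (g has_derivative D x) (at x)) \<and> (\<forall>v. (\<lambda>x. D x v) \<in> ?F)"
  proof (rule exI[of _ "\<lambda>x v. \<Sum>b\<in>Basis. D b x v *\<^sub>R b"], intro conjI ballI allI)
    show "(g has_derivative (\<lambda>v. \<Sum>b\<in>Basis. D b x v *\<^sub>R b)) (at x)" if "x \<in> part2 -` U" for x
      using that D(1) by (subst has_derivative_componentwise_within) simp
    show "(\<lambda>x. \<Sum>b\<in>Basis. D b x v *\<^sub>R b) \<in> ?F" for v
      using D(2) by simp
  qed
qed

section \<open>Warped structures in homogeneous coordinates and their smoothness\<close>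

lemma smooth_on_cong:
  "open S \<Longrightarrow> (\<And>x. x \<in> S \<Longrightarrow> f x = g x) \<Longrightarrow> smooth_on f S \<Longrightarrow> smooth_on g S"
  unfolding smooth_on_def using Ck_on_cong by blast

text \<open>The structure of the point \<open>\<beta> / \<alpha>\<close> of the projective line, in homogeneous coordinates; meaningless if both vanish.\<close>

definition hom_ocs :: "complex \<Rightarrow> complex \<Rightarrow> real ^ 4 ^ 4" where
  "hom_ocs \<alpha> \<beta> = (let s = (cmod \<alpha>)\<^sup>2 + (cmod \<beta>)\<^sup>2
     in skew4 (((cmod \<alpha>)\<^sup>2 - (cmod \<beta>)\<^sup>2) / s) (2 * Re (\<beta> * cnj \<alpha>) / s) (2 * Im (\<beta> * cnj \<alpha>) / s))"

lemma sphere_ocs_Fin: "sphere_ocs (Fin w) = hom_ocs 1 w"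
  by (simp add: sphere_ocs_def hom_ocs_def Let_def)

text \<open>The point \<open>1 / w\<close> is \<open>\<beta> / \<alpha>\<close> with
  \<open>\<alpha> = w\<close> and \<open>\<beta> = 1\<close>, and these coordinates remain
  legitimate at \<open>w = 0\<close>, where they give infinity. Hence one formula covers the poles
  of \<open>f\<close>.\<close>

lemma sphere_ocs_inverse_chart: "sphere_ocs (P1_inverse_chart w) = hom_ocs w 1"
proof (cases "w = 0")
  case True
  then show ?thesis by (simp add: P1_inverse_chart_def hom_ocs_def sphere_ocs_def)
next
  case False
  define n where "n = (cmod w)\<^sup>2"
  have n: "n > 0" using False by (simp add: n_def)
  have inv: "1 / w = cnj w / of_real n"
    using complex_div_cnj[of 1 w] by (simp add: n_def)
  have "(cmod (1 / w))\<^sup>2 = 1 / n"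
    by (simp add: norm_divide power_divide n_def)
  then have "1 - (cmod (1 / w))\<^sup>2 = (n - 1) / n" "1 + (cmod (1 / w))\<^sup>2 = (n + 1) / n"
    using n by (simp_all add: field_simps)
  moreover have "Re (1 / w) = Re w / n" "Im (1 / w) = - Im w / n"
    unfolding inv Re_divide_of_real Im_divide_of_real by simp_all
  ultimately show ?thesis using False n
    by (simp add: P1_inverse_chart_def hom_ocs_def sphere_ocs_def Let_def flip: n_def)
qed

text \<open>This merges the two charts into one case: \<open>(1, h)\<close> in the finite chart and
  \<open>(h, 1)\<close> near infinity, both without common zeros.\<close>

lemma holomorphic_to_P1_local:
  assumes "holomorphic_to_P1 f"
  obtains U \<alpha> \<beta> where "open U" "z \<in> U" "\<alpha> holomorphic_on U" "\<beta> holomorphic_on U"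
    "\<And>w. w \<in> U \<Longrightarrow> \<alpha> w \<noteq> 0 \<or> \<beta> w \<noteq> 0"
    "\<And>w. w \<in> U \<Longrightarrow> sphere_ocs (f w) = hom_ocs (\<alpha> w) (\<beta> w)"
proof -
  obtain U h where U: "open U" "z \<in> U" "h holomorphic_on U"
    and "(\<forall>w\<in>U. f w = Fin (h w)) \<or> (\<forall>w\<in>U. f w = P1_inverse_chart (h w))"
    using assms unfolding holomorphic_to_P1_def by blast
  then consider "\<forall>w\<in>U. f w = Fin (h w)" | "\<forall>w\<in>U. f w = P1_inverse_chart (h w)" by blast
  then show thesis
  proof cases
    case 1
    with U show ?thesis
      by (intro that[of U "\<lambda>_. 1" h]) (auto simp: sphere_ocs_Fin)
  next
    case 2
    with U show ?thesis
      by (intro that[of U h "\<lambda>_. 1"]) (auto simp: sphere_ocs_inverse_chart)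
  qed
qed

definition hom_acs :: "real \<Rightarrow> complex \<Rightarrow> complex \<Rightarrow> real ^ (4 + 2) ^ (4 + 2)" where
  "hom_acs \<sigma> \<alpha> \<beta> = block_sum (reflect4 \<sigma> ** hom_ocs \<alpha> \<beta> ** reflect4 \<sigma>) J2_std"

lemma warped_hom_acs:
  assumes "sphere_ocs (f (part2 x)) = hom_ocs \<alpha> \<beta>"
  shows "warped \<sigma> f x = hom_acs \<sigma> \<alpha> \<beta>"
  using assms by (simp add: warped_def const_ocs_def hom_acs_def)

lemma reflect4_conj_nth:
  "(reflect4 \<sigma> ** A ** reflect4 \<sigma>) $ i $ j = (if i = 4 then \<sigma> else 1) * A $ i $ j * (if j = 4 then \<sigma> else 1)"
  by (simp add: reflect4_def matrix_matrix_mult_def if_distrib[of "\<lambda>x. x * _"] if_distrib[of "\<lambda>x. _ * x"] cong: if_cong)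

text \<open>The nonzero entries are, up to sign, real polynomials in the real and imaginary parts of
  \<open>\<alpha>\<close> and \<open>\<beta>\<close> divided by
  \<open>|\<alpha>|^2 + |\<beta>|^2\<close>, and the absence of common zeros keeps that denominator
  nonzero.\<close>

lemma smooth_class_hom:
  assumes "\<alpha> holomorphic_on U" "\<beta> holomorphic_on U" "\<And>w. w \<in> U \<Longrightarrow> \<alpha> w \<noteq> 0 \<or> \<beta> w \<noteq> 0"
  shows "(\<lambda>x. hom_ocs (\<alpha> (part2 x)) (\<beta> (part2 x)) $ i $ j) \<in> smooth_class U"
proof -
  note intros = smooth_class.intros smooth_class_diff smooth_class_minus
  have sq: "(\<lambda>x. (cmod (h (part2 x)))\<^sup>2) \<in> smooth_class U" if "h holomorphic_on U" for h
    unfolding cmod_power2 unfolding power2_eq_square by (intro intros that)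
  have inv: "(\<lambda>x. inverse ((cmod (\<alpha> (part2 x)))\<^sup>2 + (cmod (\<beta> (part2 x)))\<^sup>2)) \<in> smooth_class U"
    using assms(3) by (intro intros sq assms(1,2)) (auto simp: sum_power2_eq_zero_iff)
  have a: "(\<lambda>x. ((cmod (\<alpha> (part2 x)))\<^sup>2 - (cmod (\<beta> (part2 x)))\<^sup>2) / ((cmod (\<alpha> (part2 x)))\<^sup>2 + (cmod (\<beta> (part2 x)))\<^sup>2)) \<in> smooth_class U"
    unfolding divide_inverse by (intro smooth_class.mult inv intros sq assms(1,2))
  have b: "(\<lambda>x. 2 * Re (\<beta> (part2 x) * cnj (\<alpha> (part2 x))) / ((cmod (\<alpha> (part2 x)))\<^sup>2 + (cmod (\<beta> (part2 x)))\<^sup>2)) \<in> smooth_class U"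
    unfolding divide_inverse times_complex.sel cnj.sel
    by (intro smooth_class.mult inv intros assms(1,2))
  have c: "(\<lambda>x. 2 * Im (\<beta> (part2 x) * cnj (\<alpha> (part2 x))) / ((cmod (\<alpha> (part2 x)))\<^sup>2 + (cmod (\<beta> (part2 x)))\<^sup>2)) \<in> smooth_class U"
    unfolding divide_inverse times_complex.sel cnj.sel
    by (intro smooth_class.mult inv intros assms(1,2))
  have "\<forall>i j. (\<lambda>x. hom_ocs (\<alpha> (part2 x)) (\<beta> (part2 x)) $ i $ j) \<in> smooth_class U"
    unfolding forall_4 hom_ocs_def Let_def skew4_def vector_4
    by (intro conjI intros a b c)
  then show ?thesis by blast
qed

lemma Inl_Inr_exhaust: "(\<forall>i::4+2. P i) \<longleftrightarrow> (\<forall>a. P (Inl a)) \<and> (\<forall>b. P (Inr b))"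
  by (metis sum.exhaust)

lemma smooth_on_hom_acs:
  assumes "open U" "\<alpha> holomorphic_on U" "\<beta> holomorphic_on U" "\<And>w. w \<in> U \<Longrightarrow> \<alpha> w \<noteq> 0 \<or> \<beta> w \<noteq> 0"
  shows "smooth_on (\<lambda>x. hom_acs \<sigma> (\<alpha> (part2 x)) (\<beta> (part2 x))) (part2 -` U)"
proof (rule smooth_class_imp_smooth_on[OF \<open>open U\<close>])
  have "\<forall>i j. (\<lambda>x. hom_acs \<sigma> (\<alpha> (part2 x)) (\<beta> (part2 x)) $ i $ j) \<in> smooth_class U"
    unfolding Inl_Inr_exhaust hom_acs_def block_sum_def
    by (auto simp: reflect4_conj_nth intro!: smooth_class.const smooth_class.mult smooth_class_hom assms)
  then show "(\<lambda>x. hom_acs \<sigma> (\<alpha> (part2 x)) (\<beta> (part2 x)) \<bullet> b) \<in> smooth_class U" if "b \<in> Basis" for b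
    using that by (auto simp: Basis_vec_def inner_axis)
qed

lemma smooth_on_warped:
  assumes "holomorphic_to_P1 f"
  shows "smooth_on (warped \<sigma> f) UNIV"
proof (rule smooth_on_local)
  fix x
  obtain U \<alpha> \<beta> where U: "open U" "part2 x \<in> U" "\<alpha> holomorphic_on U" "\<beta> holomorphic_on U"
    "\<And>w. w \<in> U \<Longrightarrow> \<alpha> w \<noteq> 0 \<or> \<beta> w \<noteq> 0"
    "\<And>w. w \<in> U \<Longrightarrow> sphere_ocs (f w) = hom_ocs (\<alpha> w) (\<beta> w)"
    using holomorphic_to_P1_local[OF assms] by metis
  have "smooth_on (warped \<sigma> f) (part2 -` U)"
  proof (rule smooth_on_cong)
    show "smooth_on (\<lambda>x. hom_acs \<sigma> (\<alpha> (part2 x)) (\<beta> (part2 x))) (part2 -` U)"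
      using U by (intro smooth_on_hom_acs) auto
  qed (use U open_part2_vimage in \<open>auto simp: warped_hom_acs\<close>)
  with U open_part2_vimage show "\<exists>V. open V \<and> x \<in> V \<and> smooth_on (warped \<sigma> f) V" by blast
qed

section \<open>Complex coordinates on R^6 and the holomorphic chart\<close>

definition z1 :: "R6 \<Rightarrow> complex" where
  "z1 x = Complex (x $ Inl 1) (x $ Inl 2)"

text \<open>For \<open>\<sigma> = -1\<close> the factor conjugates the coordinate and thereby
  absorbs \<open>reflect4\<close>, so that both orientations share one formula.\<close>

definition z2 :: "real \<Rightarrow> R6 \<Rightarrow> complex" where
  "z2 \<sigma> x = Complex (x $ Inl 3) (\<sigma> * x $ Inl 4)"

text \<open>The inverse of the coordinate map \<open>(z1, z2 \<sigma>, part2)\<close> when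
  \<open>\<sigma>\<close> is \<open>1\<close> or \<open>-1\<close>.\<close>

definition vec6 :: "real \<Rightarrow> complex \<Rightarrow> complex \<Rightarrow> complex \<Rightarrow> R6" where
  "vec6 \<sigma> u v w = (\<chi> i. case i of
     Inl k \<Rightarrow> (vector [Re u, Im u, Re v, \<sigma> * Im v] :: real ^ 4) $ k
   | Inr k \<Rightarrow> (vector [Re w, Im w] :: real ^ 2) $ k)"

lemma coordinates_vec6:
  assumes "\<sigma> = 1 \<or> \<sigma> = -1"
  shows "z1 (vec6 \<sigma> u v w) = u" "z2 \<sigma> (vec6 \<sigma> u v w) = v" "part2 (vec6 \<sigma> u v w) = w"
  using assms by (auto simp: z1_def z2_def part2_def vec6_def complex_eq_iff)

lemma coordinates_inject:
  assumes "\<sigma> = 1 \<or> \<sigma> = -1" "z1 x = z1 y" "z2 \<sigma> x = z2 \<sigma> y" "part2 x = part2 y"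
  shows "x = y"
  using assms by (auto simp: vec_eq_iff Inl_Inr_exhaust forall_4 forall_2 z1_def z2_def part2_def)

lemma sum_UNIV_4_2: "(\<Sum>i\<in>(UNIV :: (4 + 2) set). f i) =
    f (Inl 1) + f (Inl 2) + f (Inl 3) + f (Inl 4) + f (Inr 1) + f (Inr 2)"
  for f :: "4 + 2 \<Rightarrow> 'a::comm_monoid_add"
  unfolding UNIV_Plus_UNIV[symmetric]
  by (subst sum.Plus) (simp_all add: sum_4 sum_2 add_ac)

text \<open>This is the explicit formula for the structure at the point
  \<open>\<beta> / \<alpha>\<close>, with numerator and denominator multiplied by
  \<open>|\<alpha>|^2\<close>; in this form it also covers the point at infinity.\<close>

lemma coordinates_hom_acs:
  fixes \<alpha> \<beta> :: complex and w :: R6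
  assumes \<sigma>: "\<sigma> = 1 \<or> \<sigma> = -1"
  defines "s \<equiv> complex_of_real ((cmod \<alpha>)\<^sup>2 + (cmod \<beta>)\<^sup>2)"
  shows "z1 (hom_acs \<sigma> \<alpha> \<beta> *v w) =
      \<i> * ((\<alpha> * cnj \<alpha> - \<beta> * cnj \<beta>) * z1 w + 2 * \<beta> * cnj \<alpha> * cnj (z2 \<sigma> w)) / s"
    and "z2 \<sigma> (hom_acs \<sigma> \<alpha> \<beta> *v w) =
      \<i> * ((\<alpha> * cnj \<alpha> - \<beta> * cnj \<beta>) * z2 \<sigma> w - 2 * \<beta> * cnj \<alpha> * cnj (z1 w)) / s"
    and "part2 (hom_acs \<sigma> \<alpha> \<beta> *v w) = \<i> * part2 w"
proof -
  define t where "t = (cmod \<alpha>)\<^sup>2 + (cmod \<beta>)\<^sup>2"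
  define a where "a = ((cmod \<alpha>)\<^sup>2 - (cmod \<beta>)\<^sup>2) / t"
  define B where "B = 2 * \<beta> * cnj \<alpha> / s"
  have a: "(\<alpha> * cnj \<alpha> - \<beta> * cnj \<beta>) / s = of_real a"
    by (simp add: a_def s_def t_def flip: complex_norm_square)
  have B: "Re B = 2 * Re (\<beta> * cnj \<alpha>) / t" "Im B = 2 * Im (\<beta> * cnj \<alpha>) / t"
    unfolding B_def s_def t_def by (simp_all only: Re_divide_of_real Im_divide_of_real) simp_all
  have h: "hom_ocs \<alpha> \<beta> = skew4 a (Re B) (Im B)"
    by (simp only: hom_ocs_def Let_def a_def B t_def)
  have nth: "(hom_acs \<sigma> \<alpha> \<beta> *v w) $ i = (\<Sum>j\<in>UNIV. hom_acs \<sigma> \<alpha> \<beta> $ i $ j * w $ j)" for i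
    by (simp add: matrix_vector_mult_def)
  have "z1 (hom_acs \<sigma> \<alpha> \<beta> *v w) = \<i> * (of_real a * z1 w + B * cnj (z2 \<sigma> w))"
    "z2 \<sigma> (hom_acs \<sigma> \<alpha> \<beta> *v w) = \<i> * (of_real a * z2 \<sigma> w - B * cnj (z1 w))"
    using \<sigma> unfolding z1_def z2_def complex_eq_iff nth sum_UNIV_4_2 unfolding hom_acs_def
    by (auto simp: block_sum_def reflect4_conj_nth h skew4_def algebra_simps)
  then show "z1 (hom_acs \<sigma> \<alpha> \<beta> *v w) =
      \<i> * ((\<alpha> * cnj \<alpha> - \<beta> * cnj \<beta>) * z1 w + 2 * \<beta> * cnj \<alpha> * cnj (z2 \<sigma> w)) / s"
    and "z2 \<sigma> (hom_acs \<sigma> \<alpha> \<beta> *v w) =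
      \<i> * ((\<alpha> * cnj \<alpha> - \<beta> * cnj \<beta>) * z2 \<sigma> w - 2 * \<beta> * cnj \<alpha> * cnj (z1 w)) / s"
    unfolding a[symmetric] B_def by (simp_all add: divide_inverse algebra_simps)
  show "part2 (hom_acs \<sigma> \<alpha> \<beta> *v w) = \<i> * part2 w"
    unfolding part2_def complex_eq_iff nth sum_UNIV_4_2 unfolding hom_acs_def
    by (simp add: block_sum_def J2_std_def)
qed

text \<open>Conjugating the second equation gives a complex linear system for
  \<open>(u, cnj v)\<close> with determinant \<open>|\<alpha>|^2 + |\<beta>|^2\<close>, which the
  hypothesis makes nonzero. It serves both the injectivity of the chart and the bijectivity of its
  differential.\<close>

lemma twisted_pair_solve:
  fixes \<alpha> \<beta> p q u v :: complex
  assumes "\<alpha> \<noteq> 0 \<or> \<beta> \<noteq> 0"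
  shows "\<alpha> * u + \<beta> * cnj v = p \<and> \<alpha> * v - \<beta> * cnj u = q \<longleftrightarrow>
    u = (cnj \<alpha> * p - \<beta> * cnj q) / of_real ((cmod \<alpha>)\<^sup>2 + (cmod \<beta>)\<^sup>2) \<and>
    v = (cnj \<alpha> * q + \<beta> * cnj p) / of_real ((cmod \<alpha>)\<^sup>2 + (cmod \<beta>)\<^sup>2)"
proof -
  define s where "s = complex_of_real ((cmod \<alpha>)\<^sup>2 + (cmod \<beta>)\<^sup>2)"
  have "(cmod \<alpha>)\<^sup>2 + (cmod \<beta>)\<^sup>2 \<noteq> 0"
    using assms by (auto simp: sum_power2_eq_zero_iff)
  then have s0: "s \<noteq> 0" unfolding s_def of_real_eq_0_iff .
  have s: "s = \<alpha> * cnj \<alpha> + \<beta> * cnj \<beta>"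
    by (simp add: s_def flip: complex_norm_square)
  have cs: "cnj s = s" by (simp add: s_def)
  have "u = (cnj \<alpha> * p - \<beta> * cnj q) / s" "v = (cnj \<alpha> * q + \<beta> * cnj p) / s"
    if "\<alpha> * u + \<beta> * cnj v = p" "\<alpha> * v - \<beta> * cnj u = q"
    using s0 by (simp_all add: eq_divide_eq that[symmetric] s algebra_simps)
  moreover have "\<alpha> * u + \<beta> * cnj v = p" "\<alpha> * v - \<beta> * cnj u = q"
    if "u = (cnj \<alpha> * p - \<beta> * cnj q) / s" "v = (cnj \<alpha> * q + \<beta> * cnj p) / s"
  proof -
    have "\<alpha> * u + \<beta> * cnj v = (\<alpha> * (cnj \<alpha> * p - \<beta> * cnj q) + \<beta> * (\<alpha> * cnj q + cnj \<beta> * p)) / s"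
      by (simp add: that cs add_divide_distrib distrib_left)
    also have "\<dots> = p * s / s" by (simp add: s algebra_simps)
    finally show "\<alpha> * u + \<beta> * cnj v = p" using s0 by simp
    have "\<alpha> * v - \<beta> * cnj u = (\<alpha> * (cnj \<alpha> * q + \<beta> * cnj p) - \<beta> * (\<alpha> * cnj p - cnj \<beta> * q)) / s"
      by (simp add: that cs diff_divide_distrib right_diff_distrib)
    also have "\<dots> = q * s / s" by (simp add: s algebra_simps)
    finally show "\<alpha> * v - \<beta> * cnj u = q" using s0 by simp
  qed
  ultimately show ?thesis unfolding s_def by blast
qed

lemma has_derivative_vector_3:
  fixes f g h :: "'a::real_normed_vector \<Rightarrow> complex"
  assumes "(f has_derivative f') F" "(g has_derivative g') F" "(h has_derivative h') F"
  shows "((\<lambda>x. vector [f x, g x, h x] :: complex ^ 3) has_derivative (\<lambda>v. vector [f' v, g' v, h' v])) F"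
proof -
  have eqs: "(\<lambda>x. vector [f x, g x, h x] :: complex ^ 3) = (\<lambda>x. axis 1 (f x) + axis 2 (g x) + axis 3 (h x))"
    "(\<lambda>v. vector [f' v, g' v, h' v] :: complex ^ 3) = (\<lambda>v. axis 1 (f' v) + axis 2 (g' v) + axis 3 (h' v))"
    by (simp_all add: fun_eq_iff vec_eq_iff forall_3 axis_def)
  have axis: "bounded_linear (axis i :: complex \<Rightarrow> complex ^ 3)" for i
    by (intro linear_conv_bounded_linear[THEN iffD1] linearI) (simp_all add: vec_eq_iff axis_def)
  show ?thesis
    unfolding eqs by (intro has_derivative_add bounded_linear.has_derivative[OF axis] assms)
qed

lemma bounded_linear_z1: "bounded_linear z1"
  by (intro linear_conv_bounded_linear[THEN iffD1] linearI) (simp_all add: z1_def complex_eq_iff)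

lemma bounded_linear_z2: "bounded_linear (z2 \<sigma>)"
  by (intro linear_conv_bounded_linear[THEN iffD1] linearI) (simp_all add: z2_def complex_eq_iff algebra_simps)

definition chart :: "real \<Rightarrow> (complex \<Rightarrow> complex) \<Rightarrow> (complex \<Rightarrow> complex) \<Rightarrow> R6 \<Rightarrow> complex ^ 3" where
  "chart \<sigma> \<alpha> \<beta> x = vector
     [\<alpha> (part2 x) * z1 x + \<beta> (part2 x) * cnj (z2 \<sigma> x),
      \<alpha> (part2 x) * z2 \<sigma> x - \<beta> (part2 x) * cnj (z1 x), part2 x]"

text \<open>Once the third coordinate is fixed, the first two components of the chart are a twisted
  pair in \<open>z1\<close> and \<open>z2 \<sigma>\<close>, so the chart is injective on the whole
  preimage of \<open>U\<close>. Its differential has the same shape up to multiples of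
  \<open>part2\<close>.\<close>

lemma integrable_acs_warped:
  assumes f: "holomorphic_to_P1 f" and \<sigma>: "\<sigma> = 1 \<or> \<sigma> = -1"
  shows "integrable_acs (warped \<sigma> f)"
  unfolding integrable_acs_def
proof
  fix p :: R6
  obtain U \<alpha> \<beta> where U: "open U" "part2 p \<in> U" "\<alpha> holomorphic_on U" "\<beta> holomorphic_on U"
    and ne: "\<And>w. w \<in> U \<Longrightarrow> \<alpha> w \<noteq> 0 \<or> \<beta> w \<noteq> 0"
    and loc: "\<And>w. w \<in> U \<Longrightarrow> sphere_ocs (f w) = hom_ocs (\<alpha> w) (\<beta> w)"
    using holomorphic_to_P1_local[OF f] by metis
  let ?\<phi> = "chart \<sigma> \<alpha> \<beta>"
  note intros = smooth_class.intros smooth_class_diff smooth_class_minus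
  have id: "(\<lambda>z. z) holomorphic_on U" by (intro holomorphic_intros)
  have "\<forall>i. (\<lambda>x. Re (?\<phi> x $ i)) \<in> smooth_class U" "\<forall>i. (\<lambda>x. Im (?\<phi> x $ i)) \<in> smooth_class U"
    unfolding forall_3 chart_def vector_3 plus_complex.sel minus_complex.sel times_complex.sel cnj.sel
      z1_def z2_def complex.sel
    by (intro conjI intros U(3,4) smooth_class.Re_hol[OF id] smooth_class.Im_hol[OF id])+
  then have smooth: "smooth_on ?\<phi> (part2 -` U)"
    by (intro smooth_class_imp_smooth_on[OF U(1)]) (auto simp: Basis_vec_def Basis_complex_def inner_axis)
  have inj: "inj_on ?\<phi> (part2 -` U)"
  proof (rule inj_onI)
    fix x y assume xy: "x \<in> part2 -` U" "y \<in> part2 -` U" "?\<phi> x = ?\<phi> y"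
    then have eq: "part2 x = part2 y"
      "\<alpha> (part2 x) * z1 x + \<beta> (part2 x) * cnj (z2 \<sigma> x) = \<alpha> (part2 x) * z1 y + \<beta> (part2 x) * cnj (z2 \<sigma> y)"
      "\<alpha> (part2 x) * z2 \<sigma> x - \<beta> (part2 x) * cnj (z1 x) = \<alpha> (part2 x) * z2 \<sigma> y - \<beta> (part2 x) * cnj (z1 y)"
      by (auto simp: chart_def vec_eq_iff forall_3)
    have n: "\<alpha> (part2 x) \<noteq> 0 \<or> \<beta> (part2 x) \<noteq> 0" using ne xy by simp
    have "z1 x = z1 y \<and> z2 \<sigma> x = z2 \<sigma> y"
      using twisted_pair_solve[OF n, of "z1 x" "z2 \<sigma> x"] twisted_pair_solve[OF n, of "z1 y" "z2 \<sigma> y"] eq(2,3)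
      by metis
    then show "x = y" using eq(1) \<sigma> by (intro coordinates_inject[OF \<sigma>]) auto
  qed
  have deriv: "bij (frechet_derivative ?\<phi> (at q)) \<and>
      (\<forall>w. frechet_derivative ?\<phi> (at q) (warped \<sigma> f q *v w) = \<i> *s frechet_derivative ?\<phi> (at q) w)"
    if q: "q \<in> part2 -` U" for q
  proof -
    define a b where "a = \<alpha> (part2 q)" and "b = \<beta> (part2 q)"
    have ab: "a \<noteq> 0 \<or> b \<noteq> 0" using ne q by (simp add: a_def b_def)
    \<comment> \<open>\<open>c\<close> and \<open>d\<close> collect the terms from differentiating
      \<open>\<alpha>\<close> and \<open>\<beta>\<close>. They multiply \<open>part2 w\<close>,
      which is itself of type (1,0), so they do not disturb complex linearity.\<close>
    define c d where "c = deriv \<alpha> (part2 q) * z1 q + deriv \<beta> (part2 q) * cnj (z2 \<sigma> q)"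
      and "d = deriv \<alpha> (part2 q) * z2 \<sigma> q - deriv \<beta> (part2 q) * cnj (z1 q)"
    define D :: "R6 \<Rightarrow> complex ^ 3" where "D w = vector
      [a * z1 w + b * cnj (z2 \<sigma> w) + c * part2 w, a * z2 \<sigma> w - b * cnj (z1 w) + d * part2 w, part2 w]" for w
    have z: "(z1 has_derivative z1) (at q)" "(z2 \<sigma> has_derivative z2 \<sigma>) (at q)"
      using bounded_linear_z1 bounded_linear_z2 bounded_linear_imp_has_derivative by blast+
    have cz: "((\<lambda>x. cnj (z1 x)) has_derivative (\<lambda>x. cnj (z1 x))) (at q)"
      "((\<lambda>x. cnj (z2 \<sigma> x)) has_derivative (\<lambda>x. cnj (z2 \<sigma> x))) (at q)"
      using z by (auto intro: bounded_linear.has_derivative[OF bounded_linear_cnj])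
    have h: "((\<lambda>x. \<alpha> (part2 x)) has_derivative (\<lambda>v. deriv \<alpha> (part2 q) * part2 v)) (at q)"
      "((\<lambda>x. \<beta> (part2 x)) has_derivative (\<lambda>v. deriv \<beta> (part2 q) * part2 v)) (at q)"
      using q U by (auto intro!: has_derivative_hol_part2)
    have "(?\<phi> has_derivative (\<lambda>w. vector
       [\<alpha> (part2 q) * z1 w + deriv \<alpha> (part2 q) * part2 w * z1 q
          + (\<beta> (part2 q) * cnj (z2 \<sigma> w) + deriv \<beta> (part2 q) * part2 w * cnj (z2 \<sigma> q)),
        \<alpha> (part2 q) * z2 \<sigma> w + deriv \<alpha> (part2 q) * part2 w * z2 \<sigma> q
          - (\<beta> (part2 q) * cnj (z1 w) + deriv \<beta> (part2 q) * part2 w * cnj (z1 q)), part2 w])) (at q)"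
      unfolding chart_def[abs_def]
      by (intro has_derivative_vector_3 has_derivative_add has_derivative_diff has_derivative_mult h z cz
          has_derivative_part2 has_derivative_ident)
    moreover have "(\<lambda>w. vector
       [\<alpha> (part2 q) * z1 w + deriv \<alpha> (part2 q) * part2 w * z1 q
          + (\<beta> (part2 q) * cnj (z2 \<sigma> w) + deriv \<beta> (part2 q) * part2 w * cnj (z2 \<sigma> q)),
        \<alpha> (part2 q) * z2 \<sigma> w + deriv \<alpha> (part2 q) * part2 w * z2 \<sigma> q
          - (\<beta> (part2 q) * cnj (z1 w) + deriv \<beta> (part2 q) * part2 w * cnj (z1 q)), part2 w]) = D"
      by (simp add: fun_eq_iff D_def a_def b_def c_def d_def algebra_simps)
    ultimately have D: "frechet_derivative ?\<phi> (at q) = D"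
      using frechet_derivative_at by metis
    have "inj D"
    proof (rule injI)
      fix x y assume "D x = D y"
      then have eq: "part2 x = part2 y" "a * z1 x + b * cnj (z2 \<sigma> x) = a * z1 y + b * cnj (z2 \<sigma> y)"
        "a * z2 \<sigma> x - b * cnj (z1 x) = a * z2 \<sigma> y - b * cnj (z1 y)"
        by (auto simp: D_def vec_eq_iff forall_3)
      then have "z1 x = z1 y \<and> z2 \<sigma> x = z2 \<sigma> y"
        using twisted_pair_solve[OF ab, of "z1 x" "z2 \<sigma> x"] twisted_pair_solve[OF ab, of "z1 y" "z2 \<sigma> y"]
        by metis
      then show "x = y" using eq(1) \<sigma> by (intro coordinates_inject[OF \<sigma>]) auto
    qed
    moreover have "surj D"
      unfolding surj_def
    proof
      fix y :: "complex ^ 3"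
      \<comment> \<open>The third component of a preimage must be \<open>y $ 3\<close>; subtracting
        its contribution leaves a twisted pair for the other two.\<close>
      define P Q where "P = y $ 1 - c * y $ 3" and "Q = y $ 2 - d * y $ 3"
      define u v where "u = (cnj a * P - b * cnj Q) / of_real ((cmod a)\<^sup>2 + (cmod b)\<^sup>2)"
        and "v = (cnj a * Q + b * cnj P) / of_real ((cmod a)\<^sup>2 + (cmod b)\<^sup>2)"
      have uv: "a * u + b * cnj v = P" "a * v - b * cnj u = Q"
        using twisted_pair_solve[OF ab, of u v P Q] by (simp_all add: u_def v_def)
      have "D (vec6 \<sigma> u v (y $ 3)) = y"
        by (simp add: D_def coordinates_vec6[OF \<sigma>] uv vec_eq_iff forall_3) (simp add: P_def Q_def)
      then show "\<exists>x. y = D x" by metis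
    qed
    moreover have "D (warped \<sigma> f q *v w) = \<i> *s D w" for w
    proof -
      define s where "s = complex_of_real ((cmod a)\<^sup>2 + (cmod b)\<^sup>2)"
      have "(cmod a)\<^sup>2 + (cmod b)\<^sup>2 \<noteq> 0"
        using ab by (auto simp: sum_power2_eq_zero_iff)
      then have s0: "s \<noteq> 0" unfolding s_def of_real_eq_0_iff .
      have s: "s = a * cnj a + b * cnj b"
        by (simp add: s_def flip: complex_norm_square)
      have W: "warped \<sigma> f q = hom_acs \<sigma> a b"
        using loc q by (simp add: warped_hom_acs a_def b_def)
      note co = coordinates_hom_acs[OF \<sigma>, of a b w, folded W s_def]
      have cs: "cnj s = s" by (simp add: s_def)
      define Z1 Z2 where "Z1 = z1 w" and "Z2 = z2 \<sigma> w"
      have "a * z1 (warped \<sigma> f q *v w) + b * cnj (z2 \<sigma> (warped \<sigma> f q *v w)) =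
         \<i> * (a * ((a * cnj a - b * cnj b) * Z1 + 2 * b * cnj a * cnj Z2)
           - b * ((a * cnj a - b * cnj b) * cnj Z2 - 2 * cnj b * a * Z1)) / s"
        unfolding co by (simp add: cs Z1_def Z2_def divide_inverse algebra_simps)
      \<comment> \<open>The coefficient of \<open>Z1\<close> is
        \<open>a (|a|^2 - |b|^2) + 2 a |b|^2 = a s\<close>, that of \<open>cnj Z2\<close> is
        \<open>2 b |a|^2 - b (|a|^2 - |b|^2) = b s\<close>.\<close>
      also have "\<dots> = \<i> * (a * Z1 + b * cnj Z2) * s / s"
        by (simp add: s algebra_simps)
      finally have 1: "a * z1 (warped \<sigma> f q *v w) + b * cnj (z2 \<sigma> (warped \<sigma> f q *v w)) = \<i> * (a * Z1 + b * cnj Z2)"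
        using s0 by simp
      have "a * z2 \<sigma> (warped \<sigma> f q *v w) - b * cnj (z1 (warped \<sigma> f q *v w)) =
         \<i> * (a * ((a * cnj a - b * cnj b) * Z2 - 2 * b * cnj a * cnj Z1)
           + b * ((a * cnj a - b * cnj b) * cnj Z1 + 2 * cnj b * a * Z2)) / s"
        unfolding co by (simp add: cs Z1_def Z2_def divide_inverse algebra_simps)
      also have "\<dots> = \<i> * (a * Z2 - b * cnj Z1) * s / s"
        by (simp add: s algebra_simps)
      finally have 2: "a * z2 \<sigma> (warped \<sigma> f q *v w) - b * cnj (z1 (warped \<sigma> f q *v w)) = \<i> * (a * Z2 - b * cnj Z1)"
        using s0 by simp
      show ?thesis
        unfolding D_def 1 2 co(3)
        by (simp add: vec_eq_iff forall_3 Z1_def Z2_def algebra_simps)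
    qed
    ultimately show ?thesis unfolding D bij_def by blast
  qed
  show "\<exists>U (\<phi> :: R6 \<Rightarrow> complex ^ 3). open U \<and> p \<in> U \<and> smooth_on \<phi> U \<and> inj_on \<phi> U \<and>
     (\<forall>q\<in>U. bij (frechet_derivative \<phi> (at q)) \<and>
        (\<forall>w. frechet_derivative \<phi> (at q) (warped \<sigma> f q *v w) = \<i> *s frechet_derivative \<phi> (at q) w))"
    using U(2) open_part2_vimage[OF U(1)] smooth inj deriv
    by (intro exI[of _ "part2 -` U"] exI[of _ ?\<phi>]) auto
qed

section \<open>Algebraic conditions and periodicity on the torus\<close>

lemma block_sum_mult: "block_sum A B ** block_sum C D = block_sum (A ** C) (B ** D)"
  by (simp add: vec_eq_iff Inl_Inr_exhaust block_sum_def matrix_matrix_mult_def sum_UNIV_4_2 sum_4 sum_2 add_ac)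

lemma block_sum_transpose: "transpose (block_sum A B) = block_sum (transpose A) (transpose B)"
  by (simp add: vec_eq_iff Inl_Inr_exhaust block_sum_def transpose_def)

lemma torus_ocs_warped:
  assumes f: "f \<in> elliptic_to_P1 L2" and \<sigma>: "\<sigma> = 1 \<or> \<sigma> = -1"
  shows "torus_ocs (product_lattice L4 L2) (warped \<sigma> f)"
proof -
  have hol: "holomorphic_to_P1 f" and per: "periodic L2 f"
    using f by (auto simp: elliptic_to_P1_def)
  have "periodic (product_lattice L4 L2) (warped \<sigma> f)"
    using per by (simp add: periodic_def product_lattice_def warped_def part2_add)
  moreover have "warped \<sigma> f x ** warped \<sigma> f x = - mat 1" "orthogonal_matrix (warped \<sigma> f x)" for x
  proof -
    have A: "const_ocs \<sigma> (f (part2 x)) \<in> linear_ocs4 \<sigma>"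
      using bij_betw_const_ocs[OF \<sigma>] by (auto simp: bij_betw_def)
    have J2: "J2_std ** J2_std = - mat 1" "transpose J2_std ** J2_std = mat 1"
      by (simp_all add: vec_eq_iff forall_2 matrix_matrix_mult_def sum_2 J2_std_def mat_def transpose_def)
    show "warped \<sigma> f x ** warped \<sigma> f x = - mat 1"
      using A J2 unfolding linear_ocs4_def warped_def block_sum_mult
      by (simp add: vec_eq_iff Inl_Inr_exhaust block_sum_def mat_def)
    show "orthogonal_matrix (warped \<sigma> f x)"
      using A J2 unfolding linear_ocs4_def warped_def orthogonal_matrix block_sum_transpose block_sum_mult
      by (simp add: vec_eq_iff Inl_Inr_exhaust block_sum_def mat_def)
  qed
  ultimately show ?thesis
    using smooth_on_warped[OF hol] integrable_acs_warped[OF hol \<sigma>] by (simp add: torus_ocs_def)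
qed

section \<open>Energy\<close>

definition conformal_factor :: "real ^ 'n \<Rightarrow> real" where
  "conformal_factor x = 2 / (1 + (norm x)\<^sup>2)"

lemma conformal_factor_pos: "conformal_factor x > 0"
  by (simp add: conformal_factor_def add_pos_nonneg)

text \<open>Stereographic projection is conformal: the deviation from a multiple of the Euclidean
  product carries the factor \<open>?l * (1 + x \<bullet> x) - 2\<close>, which vanishes by the
  choice of \<open>conformal_factor\<close>.\<close>

lemma round_metric_eq:
  "round_metric x = (\<chi> i j. if i = j then (conformal_factor x)\<^sup>2 else 0)" for x :: "real ^ 'n::finite"
proof -
  let ?l = "conformal_factor x"
  have pos: "1 + (norm y)\<^sup>2 > 0" for y :: "real ^ 'n" by (simp add: add_pos_nonneg)
  have l: "?l * (1 + x \<bullet> x) = 2"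
    using pos[of x] by (simp add: conformal_factor_def power2_norm_eq_inner field_simps)
  \<comment> \<open>The last coordinate of the sphere is \<open>1 - conformal_factor y\<close>, so
    the only nontrivial derivative is that of the factor.\<close>
  have inv: "inv_stereographic = (\<lambda>y :: real ^ 'n. (conformal_factor y *\<^sub>R y, 1 - conformal_factor y))"
  proof
    fix y :: "real ^ 'n"
    have "((norm y)\<^sup>2 - 1) / (1 + (norm y)\<^sup>2) = 1 - 2 / (1 + (norm y)\<^sup>2)"
      using pos[of y] by (simp add: field_simps)
    then show "inv_stereographic y = (conformal_factor y *\<^sub>R y, 1 - conformal_factor y)"
      by (simp add: inv_stereographic_def conformal_factor_def)
  qed
  have cf: "conformal_factor = (\<lambda>y :: real ^ 'n. 2 * inverse (1 + y \<bullet> y))"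
    by (simp add: fun_eq_iff conformal_factor_def divide_inverse power2_norm_eq_inner)
  have dl: "(conformal_factor has_derivative (\<lambda>v. - (?l\<^sup>2 * (x \<bullet> v)))) (at x)"
  proof -
    have "1 + x \<bullet> x \<noteq> 0" using l by auto
    then have "(conformal_factor has_derivative
        (\<lambda>v. 2 * - (inverse (1 + x \<bullet> x) * (x \<bullet> v + v \<bullet> x) * inverse (1 + x \<bullet> x)))) (at x)"
      unfolding cf by (auto intro!: derivative_eq_intros)
    moreover have "2 * - (inverse (1 + x \<bullet> x) * (x \<bullet> v + v \<bullet> x) * inverse (1 + x \<bullet> x)) = - (?l\<^sup>2 * (x \<bullet> v))" for v
      unfolding cf by (simp add: power2_eq_square inner_commute[of v x])
    ultimately show ?thesis by simp
  qed
  have D: "frechet_derivative inv_stereographic (at x) =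
      (\<lambda>v. (?l *\<^sub>R v + - (?l\<^sup>2 * (x \<bullet> v)) *\<^sub>R x, 0 - - (?l\<^sup>2 * (x \<bullet> v))))"
    unfolding inv
    by (rule frechet_derivative_at[symmetric])
      (intro has_derivative_Pair has_derivative_scaleR has_derivative_diff dl has_derivative_ident has_derivative_const)
  have "frechet_derivative inv_stereographic (at x) v \<bullet> frechet_derivative inv_stereographic (at x) w
      = ?l\<^sup>2 * (v \<bullet> w)" for v w
  proof -
    have "frechet_derivative inv_stereographic (at x) v \<bullet> frechet_derivative inv_stereographic (at x) w
      = ?l\<^sup>2 * (v \<bullet> w) + ?l ^ 3 * (x \<bullet> v) * (x \<bullet> w) * (?l * (1 + x \<bullet> x) - 2)"
      unfolding D
      by (simp add: inner_Pair inner_add_left inner_add_right inner_commute[of v x] inner_commute[of w x])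
        (simp add: power2_eq_square power3_eq_cube inner_commute[of v x] inner_commute[of w x] algebra_simps)
    then show ?thesis by (simp add: l)
  qed
  then show ?thesis
    by (simp add: round_metric_def vec_eq_iff inner_axis_axis)
qed

lemma matrix_inv_round_metric:
  "matrix_inv (round_metric x) = (\<chi> i j. if i = j then inverse ((conformal_factor x)\<^sup>2) else 0)"
  (is "_ = ?B") for x :: "real ^ 'n::finite"
proof -
  let ?A = "round_metric x"
  have AB: "?A ** ?B = mat 1"
    using conformal_factor_pos[of x]
    by (simp add: round_metric_eq vec_eq_iff matrix_matrix_mult_def mat_def
        if_distrib[of "\<lambda>x. x * _"] if_distrib[of "\<lambda>x. _ * x"] cong: if_cong)
  then have "invertible ?A" by (meson invertible_right_inverse)
  \<comment> \<open>\<open>matrix_inv\<close> is defined by choice; since a two-sided inverse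
    exists, the chosen matrix is one, and uniqueness identifies it with \<open>?B\<close>.\<close>
  then have "?A ** matrix_inv ?A = mat 1 \<and> matrix_inv ?A ** ?A = mat 1"
    unfolding invertible_def matrix_inv_def by (rule someI_ex)
  then have "matrix_inv ?A = matrix_inv ?A ** (?A ** ?B)" "(matrix_inv ?A ** ?A) ** ?B = ?B"
    by (simp_all add: AB)
  then show ?thesis by (simp add: matrix_mul_assoc)
qed

lemma christoffel_round_metric:
  fixes x :: "real ^ 'n::finite"
  defines "p \<equiv> \<lambda>i. pderiv_at i (\<lambda>y. (conformal_factor y)\<^sup>2) x"
  shows "christoffel round_metric k i j x = 1 / 2 * inverse ((conformal_factor x)\<^sup>2) *
    ((if j = k then p i else 0) + (if i = k then p j else 0) - (if i = j then p k else 0))"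
proof -
  have pd: "pderiv_at i (\<lambda>y. round_metric y $ j $ l) x = (if j = l then p i else 0)" for i j l
    by (simp add: round_metric_eq pderiv_at_def p_def frechet_derivative_const)
  show ?thesis
    unfolding christoffel_def matrix_inv_round_metric pd
    by (simp add: if_distrib[of "\<lambda>x. x * _"] cong: if_cong)
qed

text \<open>The Christoffel terms cancel because the structure is block diagonal and the derivative direction
  is in a different block than both matrix indices.\<close>

lemma cov_deriv_warped:
  "cov_deriv round_metric (warped \<sigma> f) (Inr c) (Inl a) (Inl b) x
    = pderiv_at (Inr c) (\<lambda>y. warped \<sigma> f y $ Inl a $ Inl b) x"
proof -
  have J: "warped \<sigma> f x $ Inl a $ Inr c = 0" "warped \<sigma> f x $ Inr c $ Inl b = 0" for a b c
    by (simp_all add: warped_def block_sum_def)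
  show ?thesis
    unfolding cov_deriv_def christoffel_round_metric
    by (simp add: if_distrib[of "\<lambda>x. x * _"] if_distrib[of "\<lambda>x. _ * x"] distrib_left distrib_right
        left_diff_distrib right_diff_distrib sum.distrib sum_subtractf J cong: if_cong)
qed

lemma sum_UNIV_single: "(\<And>j. j \<noteq> i \<Longrightarrow> g j = 0) \<Longrightarrow> sum g UNIV = g i"
  for g :: "'a::finite \<Rightarrow> 'b::comm_monoid_add"
  by (subst sum.remove[of UNIV i]) auto

text \<open>Only the diagonal terms of the sixfold sum survive for a diagonal metric. Two inverse
  metrics against one metric leave the weight -2 in the conformal factor under the root.\<close>

lemma norm_cov_deriv_round_metric:
  fixes x :: "real ^ 'n::finite"
  shows "norm_cov_deriv round_metric J x = sqrt (\<Sum>i\<in>UNIV. \<Sum>j\<in>UNIV. \<Sum>k\<in>UNIV.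
     (cov_deriv round_metric J i k j x)\<^sup>2) / conformal_factor x"
proof -
  let ?l = "conformal_factor x"
  let ?T = "\<lambda>i i' j j' k k'. matrix_inv (round_metric x) $ i $ i' * matrix_inv (round_metric x) $ j $ j' *
    round_metric x $ k $ k' * cov_deriv round_metric J i k j x * cov_deriv round_metric J i' k' j' x"
  have T: "?T i i' j j' k k' = 0" if "i' \<noteq> i \<or> j' \<noteq> j \<or> k' \<noteq> k" for i i' j j' k k'
    using that unfolding matrix_inv_round_metric by (auto simp: round_metric_eq)
  have "(\<Sum>i'\<in>UNIV. \<Sum>j\<in>UNIV. \<Sum>j'\<in>UNIV. \<Sum>k\<in>UNIV. \<Sum>k'\<in>UNIV. ?T i i' j j' k k') =
      (\<Sum>j\<in>UNIV. \<Sum>k\<in>UNIV. ?T i i j j k k)" for i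
  proof -
    have "(\<Sum>i'\<in>UNIV. \<Sum>j\<in>UNIV. \<Sum>j'\<in>UNIV. \<Sum>k\<in>UNIV. \<Sum>k'\<in>UNIV. ?T i i' j j' k k') =
        (\<Sum>j\<in>UNIV. \<Sum>j'\<in>UNIV. \<Sum>k\<in>UNIV. \<Sum>k'\<in>UNIV. ?T i i j j' k k')"
      by (rule sum_UNIV_single) (intro sum.neutral ballI T disjI1)
    also have "\<dots> = (\<Sum>j\<in>UNIV. \<Sum>k\<in>UNIV. \<Sum>k'\<in>UNIV. ?T i i j j k k')"
      by (intro sum.cong refl sum_UNIV_single) (intro sum.neutral ballI T disjI1 disjI2)
    also have "\<dots> = (\<Sum>j\<in>UNIV. \<Sum>k\<in>UNIV. ?T i i j j k k)"
      by (intro sum.cong refl sum_UNIV_single) (intro T disjI2)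
    finally show ?thesis .
  qed
  then have "norm_cov_deriv round_metric J x = sqrt (\<Sum>i\<in>UNIV. \<Sum>j\<in>UNIV. \<Sum>k\<in>UNIV.
     inverse (?l\<^sup>2) * inverse (?l\<^sup>2) * ?l\<^sup>2 * (cov_deriv round_metric J i k j x)\<^sup>2)"
    unfolding norm_cov_deriv_def matrix_inv_round_metric
    by (simp add: round_metric_eq power2_eq_square mult.assoc)
  also have "\<dots> = sqrt (inverse (?l\<^sup>2) * (\<Sum>i\<in>UNIV. \<Sum>j\<in>UNIV. \<Sum>k\<in>UNIV. (cov_deriv round_metric J i k j x)\<^sup>2))"
    proof -
    have "inverse (?l\<^sup>2) * inverse (?l\<^sup>2) * ?l\<^sup>2 = inverse (?l\<^sup>2)"
      using conformal_factor_pos[of x] by simp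
    then show ?thesis by (simp only: sum_distrib_left)
  qed
  finally show ?thesis
    using conformal_factor_pos[of x] by (simp add: real_sqrt_mult real_sqrt_inverse divide_inverse mult.commute)
qed

lemma det_round_metric: "det (round_metric x) = (conformal_factor x)\<^sup>2 ^ CARD('n)"
  for x :: "real ^ 'n::finite"
  by (subst det_diagonal) (simp_all add: round_metric_eq)

text \<open>The sixth power of the norm has weight -6 in the conformal factor and the volume density
  in dimension six has weight 6, so the factor cancels. What remains is the sixth power of the
  Euclidean norm of all components, which bounds each single one.\<close>

lemma energy_density_ge:
  "\<bar>cov_deriv round_metric J i k j x\<bar> ^ 6 \<le> norm_cov_deriv round_metric J x ^ 6 * sqrt (det (round_metric x))"
  for x :: R6
proof -
  let ?l = "conformal_factor x" and ?C = "\<lambda>i j k. cov_deriv round_metric J i k j x"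
  have l: "?l > 0" by (rule conformal_factor_pos)
  have "(?C i j k)\<^sup>2 \<le> (\<Sum>k\<in>UNIV. (?C i j k)\<^sup>2)"
    by (rule member_le_sum) auto
  also have "\<dots> \<le> (\<Sum>j\<in>UNIV. \<Sum>k\<in>UNIV. (?C i j k)\<^sup>2)"
    by (rule member_le_sum[of j UNIV "\<lambda>j. \<Sum>k\<in>UNIV. (?C i j k)\<^sup>2"]) (auto intro!: sum_nonneg)
  also have "\<dots> \<le> (\<Sum>i\<in>UNIV. \<Sum>j\<in>UNIV. \<Sum>k\<in>UNIV. (?C i j k)\<^sup>2)"
    by (rule member_le_sum[of i UNIV "\<lambda>i. \<Sum>j\<in>UNIV. \<Sum>k\<in>UNIV. (?C i j k)\<^sup>2"]) (auto intro!: sum_nonneg)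
  finally have "\<bar>?C i j k\<bar> \<le> sqrt (\<Sum>i\<in>UNIV. \<Sum>j\<in>UNIV. \<Sum>k\<in>UNIV. (?C i j k)\<^sup>2)"
    by (metis real_sqrt_abs real_sqrt_le_iff)
  then have "\<bar>?C i j k\<bar> \<le> norm_cov_deriv round_metric J x * ?l"
    using l by (simp add: norm_cov_deriv_round_metric)
  then have "\<bar>?C i j k\<bar> ^ 6 \<le> (norm_cov_deriv round_metric J x * ?l) ^ 6"
    by (intro power_mono) auto
  also have "\<dots> = norm_cov_deriv round_metric J x ^ 6 * ?l ^ 6"
    by (rule power_mult_distrib)
  also have "?l ^ 6 = sqrt (det (round_metric x))"
  proof -
    have "det (round_metric x) = (?l ^ 6)\<^sup>2"
      by (simp add: det_round_metric flip: power_mult)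
    then show ?thesis using l unfolding \<open>det _ = _\<close> real_sqrt_abs by simp
  qed
  finally show ?thesis .
qed

section \<open>Divergence of the energy integral\<close>

lemma pderiv_at_shift:
  fixes F :: "real ^ 'n::finite \<Rightarrow> real"
  assumes "F differentiable (at x)" "\<And>y. F (y + t) = F y"
  shows "pderiv_at i F (x + t) = pderiv_at i F x"
proof -
  have F: "F y = F (y - t)" for y using assms(2)[of "y - t"] by simp
  have d: "(F has_derivative frechet_derivative F (at x)) (at (x + t - t))"
    using assms(1) by (simp add: frechet_derivative_works)
  have "((\<lambda>y. F (y - t)) has_derivative (\<lambda>v. frechet_derivative F (at x) v)) (at (x + t))"
    by (rule has_derivative_compose[where f = "\<lambda>y. y - t" and g = F, OF _ d]) (auto intro!: derivative_eq_intros)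
  then have "(F has_derivative frechet_derivative F (at x)) (at (x + t))"
    using F by simp
  then show ?thesis by (metis frechet_derivative_at pderiv_at_def)
qed

lemma warped_entry_has_derivative:
  assumes "holomorphic_to_P1 f"
  shows "((\<lambda>y. warped \<sigma> f y $ i $ j) has_derivative
    (\<lambda>v. frechet_derivative (warped \<sigma> f) (at x) v $ i $ j)) (at x)"
proof -
  have "Ck_on (Suc 0) (warped \<sigma> f) UNIV"
    using smooth_on_warped[OF assms] unfolding smooth_on_def by blast
  then have "(warped \<sigma> f has_derivative frechet_derivative (warped \<sigma> f) (at x)) (at x)"
    by (simp add: frechet_derivative_works)
  then show ?thesis
    by (intro bounded_linear.has_derivative[OF bounded_linear_vec_nth])
qed

text \<open>Otherwise the \<open>T^4\<close> block would be constant along \<open>T^2\<close>, and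
  injectivity of \<open>const_ocs \<sigma>\<close> would make \<open>f\<close> constant.\<close>

lemma exists_pderiv_warped_nonzero:
  assumes hol: "holomorphic_to_P1 f" and \<sigma>: "\<sigma> = 1 \<or> \<sigma> = -1" and "\<not> f constant_on UNIV"
  shows "\<exists>a b c x. pderiv_at (Inr c) (\<lambda>y. warped \<sigma> f y $ Inl a $ Inl b) x \<noteq> 0"
proof (rule ccontr)
  assume "\<not> ?thesis"
  then have 0: "pderiv_at (Inr c) (\<lambda>y. warped \<sigma> f y $ Inl a $ Inl b) x = 0" for a b c x by blast
  \<comment> \<open>A linear right inverse of \<open>part2\<close>; along it the two partial
    derivatives make up the full derivative of a function on the complex plane.\<close>
  define E :: "complex \<Rightarrow> R6" where "E v = Re v *\<^sub>R axis (Inr 1) 1 + Im v *\<^sub>R axis (Inr 2) 1" for v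
  have E: "part2 (E v) = v" for v
    by (simp add: part2_def E_def complex_eq_iff axis_def)
  have dE: "(E has_derivative E) F" for F
    unfolding E_def by (auto intro!: derivative_eq_intros)
  have "const_ocs \<sigma> (f z) $ a $ b = const_ocs \<sigma> (f w) $ a $ b" for a b z w
  proof -
    let ?F = "\<lambda>y. warped \<sigma> f y $ Inl a $ Inl b"
    have "((\<lambda>v. ?F (E v)) has_derivative (\<lambda>v. 0)) (at v)" for v
    proof -
      let ?D = "frechet_derivative ?F (at (E v))"
      have D: "(?F has_derivative ?D) (at (E v))"
        using warped_entry_has_derivative[OF hol] by (metis differentiableI frechet_derivative_works)
      then interpret bounded_linear ?D by (rule has_derivative_bounded_linear)
      have "?D (E w) = Re w *\<^sub>R ?D (axis (Inr 1) 1) + Im w *\<^sub>R ?D (axis (Inr 2) 1)" for w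
        unfolding E_def[of w] add scaleR ..
      then have "?D (E w) = 0" for w
        using 0[of 1 a b "E v"] 0[of 2 a b "E v"] by (simp add: pderiv_at_def)
      with has_derivative_compose[OF dE D] show ?thesis by simp
    qed
    then obtain c where "\<And>v. ?F (E v) = c"
      using has_derivative_zero_constant[of UNIV "\<lambda>v. ?F (E v)"] by auto
    then have "?F (E z) = ?F (E w)" by simp
    then show ?thesis by (simp add: warped_def E block_sum_def)
  qed
  then have "const_ocs \<sigma> (f z) = const_ocs \<sigma> (f w)" for z w
    by (simp add: vec_eq_iff)
  then have "f z = f w" for z w
    using bij_betw_const_ocs[OF \<sigma>] by (metis UNIV_I bij_betw_def inj_onD)
  then show False using assms(3) by (metis constant_on_def)
qed

lemma energy_warped:
  assumes hol: "holomorphic_to_P1 f" and \<sigma>: "\<sigma> = 1 \<or> \<sigma> = -1" and nc: "\<not> f constant_on UNIV"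
  shows "energy (warped \<sigma> f) = \<infinity>"
proof -
  obtain a b c x0 where x0: "pderiv_at (Inr c) (\<lambda>y. warped \<sigma> f y $ Inl a $ Inl b) x0 \<noteq> 0"
    using exists_pderiv_warped_nonzero[OF assms] by blast
  define F where "F y = warped \<sigma> f y $ Inl a $ Inl b" for y
  define G where "G = pderiv_at (Inr c) F"
  have Ck: "Ck_on (Suc 0) (warped \<sigma> f) UNIV"
    using smooth_on_warped[OF hol, of \<sigma>] unfolding smooth_on_def by blast
  have dF: "(F has_derivative (\<lambda>v. frechet_derivative (warped \<sigma> f) (at x) v $ Inl a $ Inl b)) (at x)" for x
    unfolding F_def by (rule warped_entry_has_derivative[OF hol])
  then have "G x = frechet_derivative (warped \<sigma> f) (at x) (axis (Inr c) 1) $ Inl a $ Inl b" for x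
    unfolding G_def pderiv_at_def by (metis frechet_derivative_at)
  then have "continuous_on UNIV G"
    using Ck by (auto intro!: continuous_intros)
  then have cont: "continuous_on UNIV (\<lambda>x. \<bar>G x\<bar>)"
    by (intro continuous_intros)
  \<comment> \<open>Half of the value at \<open>x0\<close> leaves room for a strict inequality,
    which continuity extends to a neighbourhood of \<open>x0\<close>.\<close>
  define \<epsilon> where "\<epsilon> = \<bar>G x0\<bar> / 2"
  have \<epsilon>: "\<epsilon> > 0" using x0 by (simp add: \<epsilon>_def G_def F_def[abs_def])
  have "open {x. \<epsilon> < \<bar>G x\<bar>}"
    by (rule open_Collect_less[OF continuous_on_const cont])
  moreover have "x0 \<in> {x. \<epsilon> < \<bar>G x\<bar>}" using \<epsilon> by (simp add: \<epsilon>_def)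
  ultimately obtain r where r: "r > 0" "ball x0 r \<subseteq> {x. \<epsilon> < \<bar>G x\<bar>}"
    by (meson openE)
  \<comment> \<open>Translations along an axis of \<open>R^4\<close> preserve \<open>part2\<close>,
    hence \<open>F\<close> and \<open>G\<close>; steps of length \<open>2 * r\<close> make the
    translated balls of radius \<open>r\<close> disjoint.\<close>
  define t :: "nat \<Rightarrow> R6" where "t n = (2 * r * real n) *\<^sub>R axis (Inl 1) 1" for n
  define B where "B n = ball (x0 + t n) r" for n
  have shift: "G (x + t n) = G x" for x n
  proof -
    have "F (y + t n) = F y" for y
      by (simp add: F_def warped_def part2_add) (simp add: part2_def t_def axis_def zero_complex.code[symmetric])
    then show ?thesis unfolding G_def
      using dF by (intro pderiv_at_shift) (auto simp: differentiable_def)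
  qed
  have GB: "\<epsilon> < \<bar>G x\<bar>" if "x \<in> B n" for x n
  proof -
    have "x - t n \<in> ball x0 r" using that by (simp add: B_def dist_norm algebra_simps)
    then show ?thesis using r(2) shift[of "x - t n" n] by auto
  qed
  have disj: "disjoint_family B"
  proof -
    have "B m \<inter> B n = {}" if "m \<noteq> n" for m n
    proof -
      have "\<bar>real m - real n\<bar> \<ge> 1" using that by linarith
      then have "2 * r * 1 \<le> 2 * r * \<bar>real m - real n\<bar>"
        using r(1) by (intro mult_left_mono) auto
      also have "\<dots> = norm (t m - t n)"
        using r(1) by (simp add: t_def abs_mult flip: scaleR_left_diff_distrib right_diff_distrib)
      finally have "r + r \<le> dist (x0 + t m) (x0 + t n)" by (simp add: dist_norm)
      then show ?thesis unfolding B_def by (rule disjoint_ballI)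
    qed
    then show ?thesis by (auto simp: disjoint_family_on_def)
  qed
  have eB: "emeasure lborel (B n) = ennreal (unit_ball_vol 6 * r ^ 6)" for n
    using r(1) by (simp add: B_def emeasure_ball)
  have "emeasure lborel (\<Union>n. B n) = (\<Sum>n. emeasure lborel (B n))"
    by (rule suminf_emeasure[OF _ disj, symmetric]) (auto simp: B_def)
  \<comment> \<open>All balls have the same positive volume, and a constant series is summable only
    if the constant is zero.\<close>
  also have "\<dots> = \<infinity>"
    proof (rule ccontr)
    assume "(\<Sum>n. emeasure lborel (B n)) \<noteq> \<infinity>"
    then have "summable (\<lambda>n :: nat. unit_ball_vol 6 * r ^ 6)"
      unfolding eB using r(1) by (intro summable_suminf_not_top) (auto simp: less_imp_le)
    then have "unit_ball_vol 6 * r ^ 6 = 0" by (simp only: summable_const_iff)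
    then show False using r(1) unit_ball_vol_pos[of 6] by simp
  qed
  finally have "emeasure lborel (\<Union>n. B n) = \<infinity>" .
  then have "\<infinity> = ennreal (\<epsilon> ^ 6) * emeasure lborel (\<Union>n. B n)"
    using \<epsilon> by (simp add: ennreal_mult_top)
  also have "\<dots> = (\<integral>\<^sup>+ x. ennreal (\<epsilon> ^ 6) * indicator (\<Union>n. B n) x \<partial>lborel)"
    by (subst nn_integral_cmult_indicator) (auto simp: B_def)
  also have "\<dots> \<le> energy (warped \<sigma> f)"
    unfolding energy_def
  proof (rule nn_integral_mono)
    fix x :: R6
    show "ennreal (\<epsilon> ^ 6) * indicator (\<Union>n. B n) x
      \<le> ennreal (norm_cov_deriv round_metric (warped \<sigma> f) x ^ 6 * sqrt (det (round_metric x)))"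
    proof (cases "x \<in> (\<Union>n. B n)")
      case True
      then have "\<epsilon> ^ 6 \<le> \<bar>G x\<bar> ^ 6" using GB \<epsilon> by (intro power_mono) (auto intro: less_imp_le)
      also have "\<dots> \<le> norm_cov_deriv round_metric (warped \<sigma> f) x ^ 6 * sqrt (det (round_metric x))"
        unfolding G_def F_def[abs_def] cov_deriv_warped[symmetric] by (rule energy_density_ge)
      finally show ?thesis using True by (simp add: ennreal_leI)
    qed simp
  qed
  finally show ?thesis by (simp add: top_unique)
qed

section \<open>An elliptic function\<close>

lemma summable_on_int_inverse_square: "(\<lambda>m :: int. 1 / (1 + (real_of_int m)\<^sup>2)) summable_on UNIV"
proof -
  have s: "summable (\<lambda>n. 1 / (1 + (real n)\<^sup>2))"
  proof (rule summable_comparison_test')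
    show "summable (\<lambda>n. inverse ((real n)\<^sup>2))" by (rule inverse_power_summable) auto
    show "norm (1 / (1 + (real n)\<^sup>2)) \<le> inverse ((real n)\<^sup>2)" if "n \<ge> 1" for n
      using that by (auto simp: field_simps add_pos_nonneg)
  qed
  then have sn: "(\<lambda>n. 1 / (1 + (real n)\<^sup>2)) summable_on UNIV"
    by (subst summable_on_UNIV_nonneg_real_iff) auto
  have "(\<lambda>m :: int. 1 / (1 + (real_of_int m)\<^sup>2)) summable_on range int"
    using sn by (subst summable_on_reindex) (auto simp: o_def)
  moreover have "(\<lambda>m :: int. 1 / (1 + (real_of_int m)\<^sup>2)) summable_on range (\<lambda>n. - int n)"
    using sn by (subst summable_on_reindex) (auto simp: o_def inj_on_def)
  ultimately have "(\<lambda>m :: int. 1 / (1 + (real_of_int m)\<^sup>2)) summable_on (range int \<union> range (\<lambda>n. - int n))"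
    by (rule summable_on_union)
  moreover have "range int \<union> range (\<lambda>n. - int n) = UNIV"
    by (auto intro: int_cases2)
  ultimately show ?thesis by simp
qed

text \<open>The real dimension of the plane forces a basis of two elements. Injectivity is recorded
  for real coefficients, as the lower bound on the norm of lattice points requires.\<close>

lemma is_lattice_complexE:
  fixes L :: "complex set"
  assumes "is_lattice L"
  obtains b d where "inj (\<lambda>(x, y). x *\<^sub>R b + y *\<^sub>R d)"
    "L = {of_int m *\<^sub>R b + of_int n *\<^sub>R d | m n. True}"
proof -
  obtain B where B: "independent B" "span B = (UNIV :: complex set)"
    and L: "L = {\<Sum>b\<in>B. of_int (c b) *\<^sub>R b | c. True}"
    using assms unfolding is_lattice_def by blast
  have "card B = 2"
    using B by (metis DIM_complex dim_UNIV dim_span_eq_card_independent)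
  then obtain b d where bd: "B = {b, d}" "b \<noteq> d" by (meson card_2_iff)
  have "inj (\<lambda>(x, y). x *\<^sub>R b + y *\<^sub>R d)"
  proof (rule injI, clarify)
    fix x y x' y' :: real
    assume "x *\<^sub>R b + y *\<^sub>R d = x' *\<^sub>R b + y' *\<^sub>R d"
    then have "(\<Sum>v\<in>B. (if v = b then x - x' else y - y') *\<^sub>R v) = 0"
      using bd by (simp add: algebra_simps)
    then have "(if v = b then x - x' else y - y') = 0" if "v \<in> B" for v
      using independentD[OF B(1), of B "\<lambda>v. if v = b then x - x' else y - y'" v] that bd(1) by simp
    from this[of b] this[of d] show "x = x' \<and> y = y'" using bd by auto
  qed
  moreover have "L = {of_int m *\<^sub>R b + of_int n *\<^sub>R d | m n. True}"
  proof (intro subset_antisym subsetI)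
    fix z assume "z \<in> L"
    then show "z \<in> {of_int m *\<^sub>R b + of_int n *\<^sub>R d | m n. True}"
      using bd by (auto simp: L)
  next
    fix z assume "z \<in> {of_int m *\<^sub>R b + of_int n *\<^sub>R d | m n. True}"
    then obtain m n where "z = of_int m *\<^sub>R b + of_int n *\<^sub>R d" by blast
    then have "z = (\<Sum>v\<in>B. of_int (if v = b then m else n) *\<^sub>R v)"
      using bd by auto
    then show "z \<in> L" unfolding L by (intro CollectI exI[of _ "\<lambda>v. if v = b then m else n"]) simp
  qed
  ultimately show thesis by (rule that)
qed

text \<open>Lattice points satisfy \<open>k * norm (m, n) \<le> cmod \<omega>\<close>, whence
  \<open>(1 + m^2) * (1 + n^2)\<close> is at most a constant times
  \<open>(1 + cmod \<omega>) ^ 4\<close>. The double series is thus dominated by a product of two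
  convergent simple series.\<close>

lemma lattice_summable:
  fixes L :: "complex set"
  assumes "is_lattice L"
  shows "(\<lambda>\<omega>. 1 / (1 + cmod \<omega>) ^ 4) summable_on L"
proof -
  obtain b d where inj: "inj (\<lambda>(x, y). x *\<^sub>R b + y *\<^sub>R d)"
    and L': "L = {of_int m *\<^sub>R b + of_int n *\<^sub>R d | m n. True}"
    by (rule is_lattice_complexE[OF assms])
  have L: "L = range (\<lambda>(m, n). of_int m *\<^sub>R b + of_int n *\<^sub>R d)"
    unfolding L' by (auto simp: image_iff)
  have "linear (\<lambda>(x, y). x *\<^sub>R b + y *\<^sub>R d)"
    by (intro linearI) (auto simp: algebra_simps)
  \<comment> \<open>An injective linear map on a finite-dimensional space is bounded below.\<close>
  then obtain k where k: "k > 0" "\<And>p. k * norm p \<le> norm (case p of (x, y) \<Rightarrow> x *\<^sub>R b + y *\<^sub>R d)"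
    using linear_inj_bounded_below_pos[OF _ inj] by metis
  let ?g = "\<lambda>(m, n). of_int m *\<^sub>R b + of_int n *\<^sub>R d"
  let ?u = "\<lambda>m :: int. 1 / (1 + (real_of_int m)\<^sup>2)"
  have "(\<lambda>(m, n). ?u m * ?u n) summable_on Sigma UNIV (\<lambda>_. UNIV)"
  proof (rule summable_on_SigmaI)
    show "((\<lambda>n. case (m, n) of (m, n) \<Rightarrow> ?u m * ?u n) has_sum ?u m * infsum ?u UNIV) UNIV" for m
      using summable_on_int_inverse_square unfolding prod.case
      by (intro has_sum_cmult_right has_sum_infsum)
    show "(\<lambda>m. ?u m * infsum ?u UNIV) summable_on UNIV"
      by (intro summable_on_cmult_left summable_on_int_inverse_square)
  qed auto
  then have sum: "(\<lambda>p. (1 + 1 / k\<^sup>2)\<^sup>2 * (case p of (m, n) \<Rightarrow> ?u m * ?u n)) summable_on UNIV"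
    by (intro summable_on_cmult_right) simp
  have "(\<lambda>p. 1 / (1 + cmod (?g p)) ^ 4) summable_on UNIV"
  proof (rule summable_on_comparison_test[OF sum])
    fix p :: "int \<times> int"
    obtain m n where p: "p = (m, n)" by fastforce
    let ?x = "(real_of_int m)\<^sup>2" and ?y = "(real_of_int n)\<^sup>2" and ?N = "cmod (?g p)"
    have "k * norm (real_of_int m, real_of_int n) \<le> ?N"
      using k(2)[of "(real_of_int m, real_of_int n)"] by (simp add: p)
    then have "(k * norm (real_of_int m, real_of_int n))\<^sup>2 \<le> ?N\<^sup>2"
      using k(1) by (intro power_mono) auto
    then have "k\<^sup>2 * (?x + ?y) \<le> ?N\<^sup>2"
      by (simp add: norm_Pair power_mult_distrib)
    then have "?x + ?y \<le> 1 / k\<^sup>2 * ?N\<^sup>2"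
      using k(1) by (simp add: field_simps)
    also have "\<dots> \<le> 1 / k\<^sup>2 * (1 + ?N)\<^sup>2"
      by (intro mult_left_mono power_mono) auto
    finally have "?x + ?y \<le> 1 / k\<^sup>2 * (1 + ?N)\<^sup>2" .
    moreover have "1 \<le> (1 + ?N)\<^sup>2" by (rule one_le_power) auto
    \<comment> \<open>In the constant \<open>1 + 1 / k^2\<close> the first summand pays for the term
      \<open>1\<close>, the second for \<open>?x + ?y\<close>.\<close>
    ultimately have le: "1 + ?x + ?y \<le> (1 + 1 / k\<^sup>2) * (1 + ?N)\<^sup>2"
      unfolding distrib_right by linarith
    have "(1 + ?x) * (1 + ?y) \<le> (1 + ?x + ?y) * (1 + ?x + ?y)"
      by (intro mult_mono) auto
    also have "\<dots> \<le> ((1 + 1 / k\<^sup>2) * (1 + ?N)\<^sup>2) * ((1 + 1 / k\<^sup>2) * (1 + ?N)\<^sup>2)"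
      by (intro mult_mono le) auto
    also have "\<dots> = (1 + 1 / k\<^sup>2)\<^sup>2 * (1 + ?N) ^ 4"
      by (simp add: power2_eq_square power4_eq_xxxx)
    finally have "(1 + ?x) * (1 + ?y) \<le> (1 + 1 / k\<^sup>2)\<^sup>2 * (1 + ?N) ^ 4" .
    moreover have "(1 + ?x) * (1 + ?y) > 0"
      by (intro mult_pos_pos add_pos_nonneg) auto
    moreover have "(1 + ?N) ^ 4 > 0"
      by (intro zero_less_power add_pos_nonneg) auto
    ultimately have "1 / (1 + ?N) ^ 4 \<le> (1 + 1 / k\<^sup>2)\<^sup>2 / ((1 + ?x) * (1 + ?y))"
      by (simp add: divide_simps mult.commute)
    then show "1 / (1 + ?N) ^ 4 \<le> (1 + 1 / k\<^sup>2)\<^sup>2 * (case p of (m, n) \<Rightarrow> ?u m * ?u n)"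
      by (simp add: p)
  qed auto
  moreover have "inj ?g"
  proof (rule injI, clarify)
    fix m n m' n' :: int
    assume "of_int m *\<^sub>R b + of_int n *\<^sub>R d = of_int m' *\<^sub>R b + of_int n' *\<^sub>R d"
    then have "(real_of_int m, real_of_int n) = (real_of_int m', real_of_int n')"
      by (intro injD[OF inj]) simp
    then show "m = m' \<and> n = n'" by simp
  qed
  ultimately show ?thesis
    unfolding L by (subst summable_on_reindex) (auto simp: o_def)
qed

section \<open>Translations, discreteness and the Eisenstein series\<close>

lemma lattice_translate:
  fixes L :: "complex set"
  assumes "is_lattice L" "l \<in> L"
  shows "bij_betw (\<lambda>\<omega>. \<omega> + l) L L"
proof -
  obtain b d where L: "L = {of_int m *\<^sub>R b + of_int n *\<^sub>R d | m n. True}"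
    by (rule is_lattice_complexE[OF assms(1)])
  have add: "x + y \<in> L" and diff: "x - y \<in> L" if xL: "x \<in> L" and yL: "y \<in> L" for x y
  proof -
    obtain m n m' n' where xy: "x = of_int m *\<^sub>R b + of_int n *\<^sub>R d" "y = of_int m' *\<^sub>R b + of_int n' *\<^sub>R d"
      using xL yL unfolding L by blast
    have "x + y = of_int (m + m') *\<^sub>R b + of_int (n + n') *\<^sub>R d"
      "x - y = of_int (m - m') *\<^sub>R b + of_int (n - n') *\<^sub>R d"
      by (simp_all add: xy algebra_simps)
    then show "x + y \<in> L" "x - y \<in> L" unfolding L by blast+
  qed
  show ?thesis
    by (rule bij_betwI[where g = "\<lambda>\<omega>. \<omega> - l"]) (use add diff assms(2) in auto)
qed

text \<open>Each point in the ball contributes at least \<open>1 / (1 + r) ^ 4\<close> to a finite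
  total. Discreteness is drawn from summability rather than from a lattice basis, so that it also
  applies to sets such as \<open>A - {p}\<close>.\<close>

lemma summable_imp_finite_Int_cball:
  fixes A :: "complex set"
  assumes "(\<lambda>\<omega>. 1 / (1 + cmod \<omega>) ^ 4) summable_on A"
  shows "finite (A \<inter> cball 0 r)"
proof (rule ccontr)
  let ?f = "\<lambda>\<omega>. 1 / (1 + cmod \<omega>) ^ 4"
  assume inf: "infinite (A \<inter> cball 0 r)"
  then obtain w where "w \<in> A \<inter> cball 0 r" by (metis finite.emptyI ex_in_conv)
  then have r: "r \<ge> 0" by (auto intro: order_trans[OF norm_ge_zero])
  obtain N where N: "infsum ?f A * (1 + r) ^ 4 < real N" by (meson reals_Archimedean2)
  obtain X where X: "finite X" "card X = N" "X \<subseteq> A \<inter> cball 0 r"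
    using infinite_arbitrarily_large[OF inf] by blast
  have "real N / (1 + r) ^ 4 = (\<Sum>\<omega>\<in>X. 1 / (1 + r) ^ 4)"
    by (simp add: X(2))
  also have "\<dots> \<le> sum ?f X"
  proof (rule sum_mono)
    fix \<omega> assume "\<omega> \<in> X"
    then have "(1 + cmod \<omega>) ^ 4 \<le> (1 + r) ^ 4" using X(3) by (intro power_mono) auto
    moreover have "(1 + cmod \<omega>) ^ 4 > 0" by (intro zero_less_power) (auto intro: add_pos_nonneg)
    ultimately show "1 / (1 + r) ^ 4 \<le> 1 / (1 + cmod \<omega>) ^ 4"
      by (intro divide_left_mono mult_pos_pos) auto
  qed
  also have "\<dots> \<le> infsum ?f A"
    using assms X by (intro finite_sum_le_infsum) auto
  finally show False using N r by (simp add: divide_le_eq)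
qed

text \<open>For a lattice this is one sixth of the second derivative of the Weierstrass function;
  with exponent 4 the series converges absolutely without correction terms. A general
  \<open>A\<close> permits removing a single pole.\<close>

definition eisenstein :: "complex set \<Rightarrow> complex \<Rightarrow> complex" where
  "eisenstein A z = (\<Sum>\<^sub>\<infinity>\<omega>\<in>A. 1 / (z - \<omega>) ^ 4)"

text \<open>Start from \<open>1 + cmod \<omega> \<le> 1 + R + cmod (z - \<omega>)\<close> and absorb
  \<open>1 + R\<close> by means of \<open>1 \<le> cmod (z - \<omega>) / \<delta>\<close>. The
  constant depends on \<open>\<delta>\<close> and \<open>R\<close> alone, which gives the uniformity
  needed for the Weierstrass test.\<close>

lemma eisenstein_majorant:
  assumes "\<delta> > 0" "\<delta> \<le> dist z \<omega>" "cmod z \<le> R"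
  shows "norm (1 / (z - \<omega>) ^ 4) \<le> ((1 + R) / \<delta> + 1) ^ 4 * (1 / (1 + cmod \<omega>) ^ 4)"
proof -
  have R: "R \<ge> 0" using assms(3) by (auto intro: order_trans[OF norm_ge_zero])
  have "1 + cmod \<omega> \<le> (1 + R) * 1 + cmod (z - \<omega>)"
    using assms(3) norm_triangle_sub[of \<omega> z] by (simp add: norm_minus_commute)
  also have "(1 + R) * 1 \<le> (1 + R) * (cmod (z - \<omega>) / \<delta>)"
    using assms(1,2) R by (intro mult_left_mono) (auto simp: dist_norm)
  finally have "1 + cmod \<omega> \<le> ((1 + R) / \<delta> + 1) * cmod (z - \<omega>)"
    by (simp add: field_simps)
  then have "(1 + cmod \<omega>) ^ 4 \<le> (((1 + R) / \<delta> + 1) * cmod (z - \<omega>)) ^ 4"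
    by (intro power_mono) auto
  moreover have "(1 + cmod \<omega>) ^ 4 > 0" by (intro zero_less_power) (auto intro: add_pos_nonneg)
  moreover have "cmod (z - \<omega>) > 0"
    using assms(1,2) unfolding dist_norm by linarith
  then have "cmod (z - \<omega>) ^ 4 > 0" by (rule zero_less_power)
  ultimately show ?thesis
    by (simp add: norm_divide norm_power power_mult_distrib divide_simps mult.commute)
qed

context
  fixes A :: "complex set"
  assumes summable: "(\<lambda>\<omega>. 1 / (1 + cmod \<omega>) ^ 4) summable_on A"
begin

text \<open>Only finitely many points of \<open>A\<close> lie near a given \<open>x\<close>, so
  \<open>x\<close> is not a limit point.\<close>

lemma closed_summable: "closed A"
proof -
  have "\<exists>e>0. \<forall>y\<in>A. dist y x < e \<longrightarrow> y = x" for x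
  proof -
    have fin: "finite (A \<inter> cball 0 (cmod x + 1))"
      by (rule summable_imp_finite_Int_cball[OF summable])
    obtain e where e: "e > 0" "\<And>y. y \<in> A \<inter> cball 0 (cmod x + 1) \<Longrightarrow> y \<noteq> x \<Longrightarrow> e \<le> dist x y"
      using finite_set_avoid[OF fin, of x] by metis
    have "y = x" if "y \<in> A" "dist y x < min e 1" for y
    proof (rule ccontr)
      assume "y \<noteq> x"
      have "cmod y \<le> cmod x + 1"
        using that(2) norm_triangle_sub[of y x] by (simp add: dist_norm)
      then show False using e(2)[of y] that \<open>y \<noteq> x\<close> by (auto simp: dist_commute)
    qed
    then show ?thesis using e(1) by (intro exI[of _ "min e 1"]) auto
  qed
  then show ?thesis
    unfolding closed_limpt islimpt_approachable by metis
qed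

lemma summable_eisenstein:
  assumes "z \<notin> A"
  shows "(\<lambda>\<omega>. 1 / (z - \<omega>) ^ 4) summable_on A"
proof -
  obtain \<delta> where "\<delta> > 0" "\<And>\<omega>. \<omega> \<in> A \<Longrightarrow> \<delta> \<le> dist z \<omega>"
    using separate_point_closed[OF closed_summable assms] by metis
  then have "(\<lambda>\<omega>. norm (1 / (z - \<omega>) ^ 4)) summable_on A"
    by (intro Infinite_Sum.abs_summable_on_comparison_test'[OF summable_on_cmult_right[OF summable] eisenstein_majorant]) auto
  then show ?thesis by (rule abs_summable_summable)
qed

text \<open>The finite partial sums are holomorphic on a small disc and converge uniformly there,
  along the net of finite subsets of \<open>A\<close>, by the Weierstrass test.\<close>

lemma holomorphic_eisenstein: "eisenstein A holomorphic_on - A"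
proof -
  have "\<exists>r>0. eisenstein A holomorphic_on ball z r" if z: "z \<notin> A" for z
  proof -
    obtain d where d: "d > 0" "\<And>\<omega>. \<omega> \<in> A \<Longrightarrow> d \<le> dist z \<omega>"
      using separate_point_closed[OF closed_summable z] by metis
    \<comment> \<open>With half the distance to \<open>A\<close> as radius, every point of
      \<open>cball z r\<close> keeps distance at least \<open>r\<close> from
      \<open>A\<close>.\<close>
    define r where "r = d / 2"
    have far: "r \<le> dist y \<omega>" if "y \<in> cball z r" "\<omega> \<in> A" for y \<omega>
      using d(2)[OF that(2)] that(1) dist_triangle[of z \<omega> y] by (simp add: r_def)
    have ul: "uniform_limit (cball z r) (\<lambda>X y. \<Sum>\<omega>\<in>X. 1 / (y - \<omega>) ^ 4) (eisenstein A) (finite_subsets_at_top A)"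
      unfolding eisenstein_def[abs_def]
    proof (rule Weierstrass_m_test_general)
      show "norm (1 / (y - \<omega>) ^ 4) \<le> ((1 + (cmod z + r)) / r + 1) ^ 4 * (1 / (1 + cmod \<omega>) ^ 4)"
        if "\<omega> \<in> A" "y \<in> cball z r" for \<omega> y
      proof (rule eisenstein_majorant)
        show "cmod y \<le> cmod z + r"
          using that norm_triangle_sub[of y z] by (simp add: dist_norm norm_minus_commute)
      qed (use far that d(1) r_def in auto)
      show "(\<lambda>\<omega>. ((1 + (cmod z + r)) / r + 1) ^ 4 * (1 / (1 + cmod \<omega>) ^ 4)) summable_on A"
        by (rule summable_on_cmult_right[OF summable])
    qed
    have ev: "\<forall>\<^sub>F X in finite_subsets_at_top A. continuous_on (cball z r) (\<lambda>y. \<Sum>\<omega>\<in>X. 1 / (y - \<omega>) ^ 4) \<and>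
        (\<lambda>y. \<Sum>\<omega>\<in>X. 1 / (y - \<omega>) ^ 4) holomorphic_on ball z r"
    proof (rule eventually_finite_subsets_at_top_weakI)
      fix X assume X: "finite X" "X \<subseteq> A"
      have "(\<lambda>y. \<Sum>\<omega>\<in>X. 1 / (y - \<omega>) ^ 4) holomorphic_on cball z r"
        using X far d(1) by (intro holomorphic_intros) (force simp: r_def)
      then show "continuous_on (cball z r) (\<lambda>y. \<Sum>\<omega>\<in>X. 1 / (y - \<omega>) ^ 4) \<and>
        (\<lambda>y. \<Sum>\<omega>\<in>X. 1 / (y - \<omega>) ^ 4) holomorphic_on ball z r"
        using holomorphic_on_imp_continuous_on holomorphic_on_subset ball_subset_cball by blast
    qed
    have "eisenstein A holomorphic_on ball z r"
      by (rule holomorphic_uniform_limit[OF ev ul finite_subsets_at_top_neq_bot])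
    then show ?thesis using d(1) by (intro exI[of _ r]) (simp add: r_def)
  qed
  then have "eisenstein A analytic_on - A"
    by (simp add: analytic_on_def)
  then show ?thesis by (rule analytic_imp_holomorphic)
qed

end

text \<open>Split off the term of \<open>p\<close>. The remaining series, over the still summable
  set \<open>A - {p}\<close>, is continuous at \<open>p\<close> and cannot compensate the
  pole.\<close>

lemma eisenstein_pole:
  assumes summable: "(\<lambda>\<omega>. 1 / (1 + cmod \<omega>) ^ 4) summable_on A" and p: "p \<in> A"
  shows "filterlim (eisenstein A) at_infinity (at p)"
proof -
  have s: "(\<lambda>\<omega>. 1 / (1 + cmod \<omega>) ^ 4) summable_on (A - {p})"
    by (rule summable_on_subset_banach[OF summable]) auto
  have "open (- (A - {p}))" using closed_summable[OF s] by (simp only: open_Compl)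
  then have "isCont (eisenstein (A - {p})) p"
    using holomorphic_on_imp_continuous_on[OF holomorphic_eisenstein[OF s]]
    by (auto simp: continuous_on_eq_continuous_at)
  then have lim: "(eisenstein (A - {p}) \<longlongrightarrow> eisenstein (A - {p}) p) (at p)"
    by (simp add: isCont_def)
  have "((\<lambda>z. (z - p) ^ 4) \<longlongrightarrow> (p - p) ^ 4) (at p)"
    by (intro tendsto_intros)
  \<comment> \<open>The target \<open>at 0\<close> records that the power does not vanish off
    \<open>p\<close>; this is what makes its inverse tend to infinity.\<close>
  then have "filterlim (\<lambda>z. (z - p) ^ 4) (at 0) (at p)"
    by (auto simp: filterlim_at eventually_at_filter)
  then have "filterlim (\<lambda>z. inverse ((z - p) ^ 4)) at_infinity (at p)"
    by (rule filterlim_compose[OF filterlim_inverse_at_infinity])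
  then have "filterlim (\<lambda>z. eisenstein (A - {p}) z + inverse ((z - p) ^ 4)) at_infinity (at p)"
    by (rule tendsto_add_filterlim_at_infinity[OF lim])
  moreover have ev: "\<forall>\<^sub>F z in at p. eisenstein (A - {p}) z + inverse ((z - p) ^ 4) = eisenstein A z"
  proof -
    have "\<forall>\<^sub>F z in at p. z \<in> - (A - {p})"
      using \<open>open (- (A - {p}))\<close> by (intro eventually_at_in_open') auto
    then show ?thesis
    proof eventually_elim
      case (elim z)
      then have "(\<Sum>\<^sub>\<infinity>\<omega>\<in>insert p (A - {p}). 1 / (z - \<omega>) ^ 4) =
          1 / (z - p) ^ 4 + (\<Sum>\<^sub>\<infinity>\<omega>\<in>A - {p}. 1 / (z - \<omega>) ^ 4)"
        by (intro infsum_insert summable_eisenstein[OF s]) auto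
      then show ?case
        using p by (simp add: eisenstein_def insert_absorb divide_inverse)
    qed
  qed
  ultimately show ?thesis
    using filterlim_cong[OF refl refl ev] by simp
qed

text \<open>Translation by \<open>l\<close> permutes \<open>L\<close>, and the term of
  \<open>\<omega> + l\<close> at \<open>z + l\<close> equals that of \<open>\<omega>\<close> at
  \<open>z\<close>.\<close>

lemma eisenstein_periodic:
  assumes "is_lattice L" "l \<in> L"
  shows "eisenstein L (z + l) = eisenstein L z"
  unfolding eisenstein_def
  by (subst infsum_reindex_bij_betw[OF lattice_translate[OF assms], symmetric]) simp

section \<open>Infinite dimension\<close>

text \<open>Closedness of every subset encodes that \<open>A\<close> is closed and discrete. Off
  \<open>A\<close> the map \<open>g\<close> is its own finite chart; near a pole
  \<open>1 / g\<close>, set to \<open>0\<close> at the pole, is holomorphic by removal of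
  singularities and represents the map in the chart at infinity.\<close>

lemma holomorphic_to_P1_extend:
  assumes A: "\<And>B. B \<subseteq> A \<Longrightarrow> closed B" and g: "g holomorphic_on - A"
    and pole: "\<And>p. p \<in> A \<Longrightarrow> filterlim g at_infinity (at p)"
  shows "holomorphic_to_P1 (\<lambda>z. if z \<in> A then Infty else Fin (g z))"
  unfolding holomorphic_to_P1_def
proof
  fix p
  show "\<exists>U h. open U \<and> p \<in> U \<and> h holomorphic_on U \<and>
     ((\<forall>w\<in>U. (if w \<in> A then Infty else Fin (g w)) = Fin (h w)) \<or>
      (\<forall>w\<in>U. (if w \<in> A then Infty else Fin (g w)) = P1_inverse_chart (h w)))"
  proof (cases "p \<in> A")
    case False
    then show ?thesis
      using g A[OF subset_refl] by (intro exI[of _ "- A"] exI[of _ g]) (auto simp: open_Compl)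
  next
    case True
    have "open (- (A - {p}))" using A[of "A - {p}"] by (auto simp only: open_Compl)
    moreover have "p \<in> - (A - {p})" by simp
    ultimately obtain e1 where e1: "e1 > 0" "ball p e1 \<subseteq> - (A - {p})"
      by (meson openE)
    have "\<forall>\<^sub>F z in at p. 1 \<le> norm (g z)"
      using pole[OF True] by (simp add: filterlim_at_infinity_conv_norm_at_top filterlim_at_top)
    then obtain e2 where e2: "e2 > 0" "\<And>z. z \<noteq> p \<Longrightarrow> dist z p < e2 \<Longrightarrow> 1 \<le> norm (g z)"
      unfolding eventually_at by blast
    define e where "e = min e1 e2"
    define h where "h z = (if z = p then 0 else 1 / g z)" for z
    have e: "e > 0" using e1 e2 by (simp add: e_def)
    have off: "z \<notin> A" "g z \<noteq> 0" if "z \<in> ball p e" "z \<noteq> p" for z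
      using that e1(2) e2(2)[of z] by (auto simp: e_def dist_commute subset_iff)
    have "g holomorphic_on ball p e - {p}"
      using off by (intro holomorphic_on_subset[OF g]) auto
    then have "(\<lambda>z. 1 / g z) holomorphic_on ball p e - {p}"
      using off by (intro holomorphic_intros) auto
    then have h1: "h holomorphic_on ball p e - {p}"
      by (rule holomorphic_transform) (auto simp: h_def)
    have h2: "(h \<longlongrightarrow> h q) (at q within ball p e)" if "q \<in> {p}" for q
    proof -
      have "((\<lambda>z. inverse (g z)) \<longlongrightarrow> 0) (at p)"
        by (rule filterlim_compose[OF tendsto_inverse_0 pole[OF True]])
      moreover have "\<forall>\<^sub>F z in at p. inverse (g z) = h z"
        by (auto simp: h_def eventually_at_filter divide_inverse)
      ultimately have "(h \<longlongrightarrow> 0) (at p)"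
        by (rule Lim_transform_eventually)
      then show ?thesis using that by (simp add: h_def tendsto_within_subset[OF _ subset_UNIV])
    qed
    have "h holomorphic_on ball p e"
      by (rule no_isolated_singularity'[OF h2 h1]) auto
    moreover have "(if w \<in> A then Infty else Fin (g w)) = P1_inverse_chart (h w)" if "w \<in> ball p e" for w
      using off[OF that] True by (auto simp: P1_inverse_chart_def h_def)
    ultimately show ?thesis
      using e by (intro exI[of _ "ball p e"] exI[of _ h]) auto
  qed
qed

section \<open>Interpolating polynomials with fixed leading term\<close>

definition lagrange :: "nat \<Rightarrow> (nat \<Rightarrow> complex) \<Rightarrow> nat \<Rightarrow> complex \<Rightarrow> complex" where
  "lagrange n a j w = (\<Prod>i\<in>{..<n} - {j}. (w - a i) / (a j - a i))"

text \<open>The factor \<open>w\<close> makes the leading term nonconstant even for \<open>n = 0\<close>.\<close>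

definition interpol :: "nat \<Rightarrow> (nat \<Rightarrow> complex) \<Rightarrow> (nat \<Rightarrow> real) \<Rightarrow> complex \<Rightarrow> complex" where
  "interpol n a c w = w * (\<Prod>i<n. w - a i) + (\<Sum>j<n. of_real (c j) * lagrange n a j w)"

lemma interpol_node:
  assumes "inj_on a {..<n}" "k < n"
  shows "interpol n a c (a k) = of_real (c k)"
proof -
  have "lagrange n a j (a k) = (if j = k then 1 else 0)" if "j < n" for j
  proof (cases "j = k")
    case True
    have "a k - a i \<noteq> 0" if "i \<in> {..<n} - {k}" for i
      using assms that by (auto dest: inj_onD)
    then show ?thesis using True by (simp add: lagrange_def)
  next
    case False
    then show ?thesis using assms(2) by (auto simp: lagrange_def intro!: prod_zero bexI[of _ k])
  qed
  then have "(\<Sum>j<n. of_real (c j) * lagrange n a j (a k)) = (\<Sum>j<n. if j = k then complex_of_real (c j) else 0)"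
    by (intro sum.cong) auto
  moreover have "(\<Prod>i<n. a k - a i) = 0" using assms(2) by (intro prod_zero) auto
  ultimately show ?thesis using assms(2) by (simp add: interpol_def)
qed

lemma lagrange_holomorphic: "lagrange n a j holomorphic_on S"
  unfolding lagrange_def divide_inverse by (intro holomorphic_intros)

lemma interpol_holomorphic: "interpol n a c holomorphic_on S"
  unfolding interpol_def by (intro holomorphic_intros lagrange_holomorphic)

text \<open>The leading term \<open>Q\<close> exceeds each Lagrange polynomial by a factor
  \<open>cmod w\<close> up to constants, so outside a large disc the other terms amount to at most
  half of it.\<close>

lemma interpol_growth:
  obtains R K where "R > 0" "\<And>w. R \<le> cmod w \<Longrightarrow> cmod w / 2 \<le> cmod (interpol n a c w)"
    "\<And>w j. R \<le> cmod w \<Longrightarrow> j < n \<Longrightarrow> cmod (lagrange n a j w) \<le> K * cmod (interpol n a c w)"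
proof -
  define k where "k j = inverse (\<Prod>i\<in>{..<n} - {j}. a j - a i)" for j
  define S where "S = (\<Sum>j<n. \<bar>c j\<bar> * cmod (k j))"
  \<comment> \<open>The first summand gives \<open>R \<ge> 1\<close>, the second keeps
    \<open>w\<close> at distance at least \<open>1\<close> from all nodes, the third yields
    \<open>S \<le> cmod w / 2\<close>.\<close>
  define R where "R = 1 + (\<Sum>j<n. cmod (a j) + 1) + 2 * S"
  define Q where "Q w = w * (\<Prod>i<n. w - a i)" for w
  have S0: "S \<ge> 0" by (simp add: S_def sum_nonneg)
  have R1: "R \<ge> 1" using S0 by (simp add: R_def sum_nonneg add_nonneg_nonneg)
  \<comment> \<open>Admitting \<open>j = n\<close> supplies an index even for \<open>n = 0\<close>,
    so that the second bound, which does not mention \<open>j\<close>, can always be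
    instantiated.\<close>
  have lag: "cmod w * cmod (lagrange n a j w) \<le> cmod (k j) * cmod (Q w)"
    and Q: "cmod w \<le> cmod (Q w)" if w: "R \<le> cmod w" and j: "j < n \<or> j = n" for w j
  proof -
    have far: "1 \<le> cmod (w - a i)" if "i < n" for i
    proof -
      have "cmod (a i) + 1 \<le> (\<Sum>j<n. cmod (a j) + 1)"
        using that by (intro member_le_sum[of i "{..<n}" "\<lambda>j. cmod (a j) + 1"]) auto
      then have "cmod (a i) + 1 \<le> cmod w" using w S0 by (simp add: R_def)
      then show ?thesis using norm_triangle_ineq2[of w "a i"] by linarith
    qed
    have "1 \<le> (\<Prod>i<n. cmod (w - a i))" using far by (intro prod_ge_1) auto
    then have "cmod w * 1 \<le> cmod w * (\<Prod>i<n. cmod (w - a i))"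
      by (intro mult_left_mono) auto
    then show "cmod w \<le> cmod (Q w)" by (simp add: Q_def norm_mult prod_norm)
    have "lagrange n a j w = k j * (\<Prod>i\<in>{..<n} - {j}. w - a i)"
      unfolding lagrange_def k_def by (simp add: prod_dividef) (simp add: divide_inverse mult.commute)
    then have lag_eq: "cmod (lagrange n a j w) = cmod (k j) * (\<Prod>i\<in>{..<n} - {j}. cmod (w - a i))"
      by (simp add: norm_mult prod_norm)
    have "(\<Prod>i\<in>{..<n} - {j}. cmod (w - a i)) \<le> (\<Prod>i<n. cmod (w - a i))"
    proof (cases "j < n")
      case True
      have "1 * (\<Prod>i\<in>{..<n} - {j}. cmod (w - a i)) \<le> cmod (w - a j) * (\<Prod>i\<in>{..<n} - {j}. cmod (w - a i))"
        using far[OF True] by (intro mult_right_mono prod_nonneg) auto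
      also have "\<dots> = (\<Prod>i<n. cmod (w - a i))"
        using True by (subst prod.remove[of "{..<n}" j]) auto
      finally show ?thesis by simp
    qed simp
    then have "cmod w * (cmod (k j) * (\<Prod>i\<in>{..<n} - {j}. cmod (w - a i)))
        \<le> cmod w * (cmod (k j) * (\<Prod>i<n. cmod (w - a i)))"
      by (intro mult_left_mono) auto
    then show "cmod w * cmod (lagrange n a j w) \<le> cmod (k j) * cmod (Q w)"
      by (simp add: lag_eq Q_def norm_mult prod_norm mult_ac)
  qed
  have half: "cmod (Q w) / 2 \<le> cmod (interpol n a c w)" if w: "R \<le> cmod w" for w
  proof -
    have w0: "cmod w > 0" using w R1 by linarith
    let ?s = "\<Sum>j<n. of_real (c j) * lagrange n a j w"
    have "cmod w * cmod ?s \<le> cmod w * (\<Sum>j<n. \<bar>c j\<bar> * cmod (lagrange n a j w))"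
      by (intro mult_left_mono order_trans[OF norm_sum]) (auto simp: norm_mult)
    also have "\<dots> = (\<Sum>j<n. \<bar>c j\<bar> * (cmod w * cmod (lagrange n a j w)))"
      by (simp add: sum_distrib_left mult_ac)
    also have "\<dots> \<le> (\<Sum>j<n. \<bar>c j\<bar> * (cmod (k j) * cmod (Q w)))"
      using lag[OF w] by (intro sum_mono mult_left_mono) auto
    also have "\<dots> = S * cmod (Q w)"
      by (simp only: S_def sum_distrib_right mult.assoc)
    also have "\<dots> \<le> (cmod w / 2) * cmod (Q w)"
    proof (rule mult_right_mono)
      have "(\<Sum>j<n. cmod (a j) + 1) \<ge> 0" by (intro sum_nonneg) auto
      then show "S \<le> cmod w / 2" using w by (simp add: R_def)
    qed simp
    finally have "cmod ?s \<le> cmod (Q w) / 2"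
      using w0 by (simp add: field_simps)
    moreover have "interpol n a c w = Q w + ?s" by (simp add: interpol_def Q_def)
    ultimately show ?thesis using norm_diff_ineq[of "Q w" ?s] by simp
  qed
  show thesis
  proof (rule that[of R "\<Sum>j<n. 2 * cmod (k j)"])
    show "R > 0" using R1 by linarith
    show "cmod w / 2 \<le> cmod (interpol n a c w)" if "R \<le> cmod w" for w
      using half[OF that] Q[OF that, of n] by simp
    show "cmod (lagrange n a j w) \<le> (\<Sum>j<n. 2 * cmod (k j)) * cmod (interpol n a c w)"
      if w: "R \<le> cmod w" and j: "j < n" for w j
    proof -
      have "1 * cmod (lagrange n a j w) \<le> cmod w * cmod (lagrange n a j w)"
        using w R1 by (intro mult_right_mono) auto
      also have "\<dots> \<le> cmod (k j) * cmod (Q w)" using lag[OF w] j by simp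
      also have "\<dots> \<le> cmod (k j) * (2 * cmod (interpol n a c w))"
        using half[OF w] by (intro mult_left_mono) auto
      also have "\<dots> = 2 * cmod (k j) * cmod (interpol n a c w)" by simp
      also have "\<dots> \<le> (\<Sum>j<n. 2 * cmod (k j)) * cmod (interpol n a c w)"
        using j by (intro mult_right_mono member_le_sum[of j "{..<n}" "\<lambda>j. 2 * cmod (k j)"]) auto
      finally show ?thesis by simp
    qed
  qed
qed

lemma interpol_at_infinity: "filterlim (interpol n a c) at_infinity at_infinity"
proof -
  obtain R K where R: "\<And>w. R \<le> cmod w \<Longrightarrow> cmod w / 2 \<le> cmod (interpol n a c w)"
    using interpol_growth[of n a c] by metis
  show ?thesis
    unfolding filterlim_at_infinity_conv_norm_at_top
  proof (rule filterlim_at_top_mono)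
    show "filterlim (\<lambda>w :: complex. 1 / 2 * norm w) at_top at_infinity"
      by (rule filterlim_tendsto_pos_mult_at_top[OF tendsto_const _ filterlim_norm_at_top]) simp
    show "\<forall>\<^sub>F w in at_infinity. 1 / 2 * norm w \<le> norm (interpol n a c w)"
      using R unfolding eventually_at_infinity by (intro exI[of _ R]) simp
  qed
qed

text \<open>Outside a large disc \<open>interpol_growth\<close> applies, inside it continuity and
  compactness. The square root is the weight of the chordal metric, so the bound does not degenerate
  where the interpolant is large; \<open>M\<close> may depend on \<open>c\<close> but not on
  \<open>w\<close>.\<close>

lemma lagrange_bound:
  obtains M where "M \<ge> 0" "\<And>w j. j < n \<Longrightarrow> cmod (lagrange n a j w) \<le> M * sqrt (1 + (cmod (interpol n a c w))\<^sup>2)"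
proof -
  obtain R K where R: "R > 0"
    "\<And>w j. R \<le> cmod w \<Longrightarrow> j < n \<Longrightarrow> cmod (lagrange n a j w) \<le> K * cmod (interpol n a c w)"
    using interpol_growth[of n a c] by metis
  have "\<exists>B. \<forall>w\<in>cball 0 R. cmod (lagrange n a j w) \<le> B" for j
  proof -
    have "compact (lagrange n a j ` cball 0 R)"
      by (intro compact_continuous_image holomorphic_on_imp_continuous_on lagrange_holomorphic compact_cball)
    then have "bounded (lagrange n a j ` cball 0 R)" by (rule compact_imp_bounded)
    then show ?thesis by (auto simp: bounded_iff)
  qed
  then obtain B where B: "\<And>j w. w \<in> cball 0 R \<Longrightarrow> cmod (lagrange n a j w) \<le> B j" by metis
  define M where "M = \<bar>K\<bar> + (\<Sum>j<n. \<bar>B j\<bar>)"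
  show thesis
  proof (rule that[of M])
    show M: "M \<ge> 0" by (simp add: M_def sum_nonneg)
    fix w j assume j: "j < n"
    let ?q = "sqrt (1 + (cmod (interpol n a c w))\<^sup>2)"
    have q: "1 \<le> ?q" "cmod (interpol n a c w) \<le> ?q"
      by (auto intro: real_le_rsqrt)
    show "cmod (lagrange n a j w) \<le> M * ?q"
    proof (cases "R \<le> cmod w")
      case True
      have "cmod (lagrange n a j w) \<le> K * cmod (interpol n a c w)" by (rule R(2)[OF True j])
      also have "\<dots> \<le> M * ?q"
        using q by (intro mult_mono) (auto simp: M_def sum_nonneg intro: add_increasing2)
      finally show ?thesis .
    next
      case False
      then have "cmod (lagrange n a j w) \<le> \<bar>B j\<bar>" using B[of w j] by (simp add: abs_le_iff)
      also have "\<dots> \<le> (\<Sum>j<n. \<bar>B j\<bar>)" using j by (intro member_le_sum[of j "{..<n}" "\<lambda>j. \<bar>B j\<bar>"]) auto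
      also have "\<dots> \<le> M * 1" by (simp add: M_def)
      also have "\<dots> \<le> M * ?q" using q(1) M by (intro mult_left_mono) auto
      finally show ?thesis .
    qed
  qed
qed

section \<open>Elliptic functions with prescribed values\<close>

definition interpol_elliptic ::
    "complex set \<Rightarrow> nat \<Rightarrow> (nat \<Rightarrow> complex) \<Rightarrow> (nat \<Rightarrow> real) \<Rightarrow> complex \<Rightarrow> P1" where
  "interpol_elliptic L n a c z = (if z \<in> L then Infty else Fin (interpol n a c (eisenstein L z)))"

text \<open>The polynomial is entire and tends to infinity at infinity, so the poles of
  \<open>eisenstein L\<close> are poles of the composite.\<close>

lemma interpol_elliptic:
  assumes L: "is_lattice L"
  shows "interpol_elliptic L n a c \<in> elliptic_to_P1 L"
proof -
  note s = lattice_summable[OF L]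
  have "holomorphic_to_P1 (\<lambda>z. if z \<in> L then Infty else Fin (interpol n a c (eisenstein L z)))"
  proof (rule holomorphic_to_P1_extend)
    show "closed B" if "B \<subseteq> L" for B
      by (rule closed_summable[OF summable_on_subset_banach[OF s that]])
    show "(\<lambda>z. interpol n a c (eisenstein L z)) holomorphic_on - L"
      using holomorphic_on_compose[OF holomorphic_eisenstein[OF s] interpol_holomorphic] by (simp add: o_def)
    show "filterlim (\<lambda>z. interpol n a c (eisenstein L z)) at_infinity (at p)" if "p \<in> L" for p
      by (rule filterlim_compose[OF interpol_at_infinity eisenstein_pole[OF s that]])
  qed
  moreover have "interpol_elliptic L n a c (z + l) = interpol_elliptic L n a c z" if l: "l \<in> L" for z l
  proof -
    have "z + l \<in> L \<longleftrightarrow> z \<in> L"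
    proof
      assume "z + l \<in> L"
      then obtain \<omega> where "\<omega> \<in> L" "z + l = \<omega> + l"
        using lattice_translate[OF L l] unfolding bij_betw_def by blast
      then show "z \<in> L" by simp
    qed (use lattice_translate[OF L l] in \<open>auto simp: bij_betw_def\<close>)
    then show ?thesis by (simp add: interpol_elliptic_def eisenstein_periodic[OF L l])
  qed
  ultimately show ?thesis
    by (simp add: elliptic_to_P1_def periodic_def interpol_elliptic_def[abs_def])
qed

lemma is_lattice_zero:
  fixes L :: "complex set"
  assumes "is_lattice L"
  shows "0 \<in> L"
proof -
  obtain b d where "L = {of_int m *\<^sub>R b + of_int n *\<^sub>R d | m n. True}"
    by (rule is_lattice_complexE[OF assms])
  moreover have "0 = real_of_int 0 *\<^sub>R b + real_of_int 0 *\<^sub>R d" by simp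
  ultimately show ?thesis by blast
qed

text \<open>Finitely many values would be bounded, against the pole at \<open>0\<close>.\<close>

lemma infinite_eisenstein_values:
  assumes L: "is_lattice L"
  shows "infinite (eisenstein L ` (- L))"
proof
  note s = lattice_summable[OF L]
  assume "finite (eisenstein L ` (- L))"
  then obtain B where B: "\<And>z. z \<notin> L \<Longrightarrow> cmod (eisenstein L z) \<le> B"
    using finite_imp_bounded[of "eisenstein L ` (- L)"] by (auto simp: bounded_iff)
  have "\<forall>\<^sub>F z in at 0. B + 1 \<le> cmod (eisenstein L z)"
    using eisenstein_pole[OF s is_lattice_zero[OF L]]
    by (simp add: filterlim_at_infinity_conv_norm_at_top filterlim_at_top)
  moreover have "\<forall>\<^sub>F z in at 0. z \<in> - (L - {0})"
  proof (rule eventually_at_in_open')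
    show "open (- (L - {0}))"
      using closed_summable[OF summable_on_subset_banach[OF s]] by (metis Diff_subset open_Compl)
  qed simp
  moreover have "\<forall>\<^sub>F z :: complex in at 0. z \<noteq> 0" by (rule eventually_neq_at_within)
  ultimately have "\<forall>\<^sub>F z :: complex in at 0. False"
  proof eventually_elim
    case (elim z)
    then show ?case using B[of z] by auto
  qed
  then show False by simp
qed

text \<open>The distinct values serve as interpolation nodes, and the points where they are attained
  as evaluation points that recover the parameters.\<close>

lemma eisenstein_nodes:
  fixes n :: nat
  assumes "is_lattice L"
  obtains z where "\<And>j. j < n \<Longrightarrow> z j \<notin> L" "inj_on (\<lambda>j. eisenstein L (z j)) {..<n}"
proof -
  obtain X where X: "finite X" "card X = n" "X \<subseteq> eisenstein L ` (- L)"
    using infinite_arbitrarily_large[OF infinite_eisenstein_values[OF assms]] by blast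
  then obtain b where b: "bij_betw b {..<n} X"
    using ex_bij_betw_nat_finite[of X] by (auto simp: lessThan_atLeast0)
  have "\<exists>z. z \<notin> L \<and> eisenstein L z = b j" if "j < n" for j
    using b X(3) that unfolding bij_betw_def by force
  then obtain z where z: "\<And>j. j < n \<Longrightarrow> z j \<notin> L \<and> eisenstein L (z j) = b j" by metis
  show thesis
  proof (rule that[of z])
    show "inj_on (\<lambda>j. eisenstein L (z j)) {..<n}"
      using b z unfolding bij_betw_def by (auto simp: inj_on_def)
  qed (use z in auto)
qed

section \<open>Boundedness and Lipschitz estimates in the chordal metric\<close>

lemma norm_matrix_le:
  fixes A :: "real ^ (4 + 2) ^ (4 + 2)"
  assumes "\<And>i j. \<bar>A $ i $ j\<bar> \<le> e"
  shows "norm A \<le> 36 * e"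
proof -
  have "norm (A $ i) \<le> 6 * e" for i
  proof -
    have "norm (A $ i) \<le> (\<Sum>j\<in>UNIV. \<bar>A $ i $ j\<bar>)" by (rule norm_le_l1_cart)
    also have "\<dots> \<le> (\<Sum>j\<in>(UNIV :: (4 + 2) set). e)" by (intro sum_mono assms)
    finally show ?thesis by simp
  qed
  then have "(\<Sum>i\<in>UNIV. norm (A $ i)) \<le> (\<Sum>i\<in>(UNIV :: (4 + 2) set). 6 * e)"
    by (intro sum_mono)
  moreover have "norm A \<le> (\<Sum>i\<in>UNIV. norm (A $ i))"
    unfolding norm_vec_def by (intro L2_set_le_sum) simp
  ultimately show ?thesis by simp
qed

lemma abs_orthogonal_matrix_entry_le:
  fixes A :: "real ^ 'n::finite ^ 'n"
  assumes "orthogonal_matrix A"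
  shows "\<bar>A $ i $ j\<bar> \<le> 1"
proof -
  have "norm (A *v axis j 1) = norm (axis j 1 :: real ^ 'n)"
    using assms by (metis orthogonal_transformation_matrix orthogonal_transformation_norm
        matrix_of_matrix_vector_mul matrix_vector_mul_linear)
  moreover have "A *v axis j 1 = column j A" by (rule matrix_vector_mult_basis)
  ultimately show ?thesis
    using component_le_norm_cart[of "column j A" i] by (simp add: column_def)
qed

lemma warped_bcontfun:
  assumes f: "f \<in> elliptic_to_P1 L" and \<sigma>: "\<sigma> = 1 \<or> \<sigma> = -1"
  shows "warped \<sigma> f \<in> bcontfun"
proof -
  \<comment> \<open>The empty set stands in for the lattice in \<open>R^4\<close>; only continuity
    and orthogonality are extracted from \<open>t\<close>.\<close>
  have t: "torus_ocs (product_lattice {} L) (warped \<sigma> f)"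
    by (rule torus_ocs_warped[OF assms])
  then have "Ck_on 0 (warped \<sigma> f) UNIV" by (simp only: torus_ocs_def smooth_on_def)
  then have "continuous_on UNIV (warped \<sigma> f)" by simp
  moreover have "norm (warped \<sigma> f x) \<le> 36 * 1" for x
    using t by (intro norm_matrix_le abs_orthogonal_matrix_entry_le) (simp add: torus_ocs_def)
  then have "bounded (range (warped \<sigma> f))" unfolding bounded_iff by blast
  ultimately show ?thesis by (simp add: bcontfun_def)
qed

text \<open>The chordal distance has \<open>sqrt (1 + |v|^2) * sqrt (1 + |w|^2)\<close> in its
  denominator. Retaining only the factor of \<open>v\<close> gives an asymmetric bound, suited to a
  fixed reference \<open>v\<close> and arbitrary \<open>w\<close>.\<close>

lemma inverse_sphere_lipschitz:
  "\<bar>1 / (1 + (cmod v)\<^sup>2) - 1 / (1 + (cmod w)\<^sup>2)\<bar> \<le> 2 * (cmod (v - w) / sqrt (1 + (cmod v)\<^sup>2))"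
  "cmod (v / of_real (1 + (cmod v)\<^sup>2) - w / of_real (1 + (cmod w)\<^sup>2)) \<le> 3 * (cmod (v - w) / sqrt (1 + (cmod v)\<^sup>2))"
proof -
  define x y where "x = cmod v" and "y = cmod w"
  define N M where "N = 1 + x\<^sup>2" and "M = 1 + y\<^sup>2"
  define q where "q = sqrt N"
  define d where "d = cmod (v - w)"
  have xy: "x \<ge> 0" "y \<ge> 0" and d: "d \<ge> 0" by (simp_all add: x_def y_def d_def)
  have N: "N \<ge> 1" and M: "M \<ge> 1" by (simp_all add: N_def M_def)
  have q: "q \<ge> 1" "q * q = N" "x \<le> q" "q \<le> N"
  proof -
    show "q \<ge> 1" using N by (simp add: q_def)
    show qq: "q * q = N" using N by (simp add: q_def)
    show "x \<le> q" unfolding q_def N_def by (rule real_le_rsqrt) simp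
    show "q \<le> N" using \<open>q \<ge> 1\<close> unfolding qq[symmetric] by simp
  qed
  have yM: "y \<le> M" using sum_power2_ge_zero[of "y - 1" "y"] zero_le_power2[of "y - 1"] zero_le_power2[of y]
    by (simp add: M_def power2_eq_square algebra_simps)
  have dxy: "\<bar>x - y\<bar> \<le> d" unfolding x_def y_def d_def by (rule norm_triangle_ineq3)
  have NM: "\<bar>M - N\<bar> \<le> d * (x + y)"
  proof -
    have "M - N = (y - x) * (x + y)" by (simp add: M_def N_def power2_eq_square algebra_simps)
    then have "\<bar>M - N\<bar> = \<bar>x - y\<bar> * (x + y)" using xy by (simp add: abs_mult abs_minus_commute)
    then show ?thesis using dxy xy by (simp add: mult_right_mono)
  qed
  have "\<bar>1 / N - 1 / M\<bar> = \<bar>M - N\<bar> / (N * M)"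
    using N M by (simp add: diff_frac_eq abs_mult)
  also have "\<dots> \<le> d * (x + y) / (N * M)"
    using NM N M by (intro divide_right_mono) auto
  \<comment> \<open>Both \<open>x\<close> and \<open>y\<close> are at most \<open>q * M\<close>;
    afterwards \<open>M\<close> cancels and \<open>N = q * q\<close> leaves one \<open>q\<close> in
    the denominator.\<close>
  also have "\<dots> \<le> d * (2 * q * M) / (N * M)"
  proof -
    have "x * 1 \<le> q * M" "1 * y \<le> q * M"
      using q M yM xy by (intro mult_mono; simp)+
    then show ?thesis using d N M by (intro divide_right_mono mult_left_mono) auto
  qed
  also have "\<dots> = 2 * (d / q)"
    using q N M unfolding q(2)[symmetric] by (simp add: field_simps)
  finally show "\<bar>1 / (1 + (cmod v)\<^sup>2) - 1 / (1 + (cmod w)\<^sup>2)\<bar> \<le> 2 * (cmod (v - w) / sqrt (1 + (cmod v)\<^sup>2))"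
    by (simp add: N_def M_def x_def y_def d_def q_def)
  \<comment> \<open>The numerator is arranged so that each term contains a quantity controlled by
    \<open>d\<close>: either \<open>v - w\<close> or \<open>M - N\<close>.\<close>
  have eq: "v / of_real N - w / of_real M = (of_real M * (v - w) + of_real (M - N) * w) / of_real (N * M)"
    using N M by (simp add: field_simps)
  have "cmod (v / of_real N - w / of_real M) = cmod (of_real M * (v - w) + of_real (M - N) * w) / (N * M)"
    using N M unfolding eq norm_divide norm_of_real by simp
  also have "\<dots> \<le> (M * d + \<bar>M - N\<bar> * y) / (N * M)"
    using N M by (intro divide_right_mono order_trans[OF norm_triangle_ineq])
      (simp_all add: norm_mult d_def y_def flip: of_real_diff)
  also have "\<dots> \<le> (3 * d * (q * M)) / (N * M)"
  proof -
    have "\<bar>M - N\<bar> * y \<le> d * (x + y) * y" using NM xy by (intro mult_right_mono) auto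
    also have "\<dots> = d * (x * y + y\<^sup>2)" by (simp add: power2_eq_square algebra_simps)
    also have "\<dots> \<le> d * (q * M + 1 * M)"
      using q yM xy M d by (intro mult_left_mono add_mono mult_mono) (auto simp: M_def)
    also have "\<dots> \<le> d * (q * M + q * M)"
      using q M d by (intro mult_left_mono add_left_mono mult_right_mono) auto
    finally have "\<bar>M - N\<bar> * y \<le> 2 * d * (q * M)" by (simp add: mult_ac)
    moreover have "M * d \<le> d * (q * M)"
      using mult_right_mono[OF q(1), of "M * d"] M d by (simp add: mult_ac)
    ultimately have "M * d + \<bar>M - N\<bar> * y \<le> 3 * d * (q * M)" by linarith
    then show ?thesis by (rule divide_right_mono) (use N M in simp)
  qed
  also have "\<dots> = 3 * (d / q)"
    using q N M unfolding q(2)[symmetric] by (simp add: field_simps)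
  finally show "cmod (v / of_real (1 + (cmod v)\<^sup>2) - w / of_real (1 + (cmod w)\<^sup>2)) \<le> 3 * (cmod (v - w) / sqrt (1 + (cmod v)\<^sup>2))"
    by (simp add: N_def M_def x_def y_def d_def q_def)
qed

text \<open>Up to sign and additive constants the nonzero entries are twice the functions, or their
  real and imaginary parts, estimated in \<open>inverse_sphere_lipschitz\<close>, so
  \<open>2 * 3\<close> serves for all of them.\<close>

lemma sphere_ocs_lipschitz:
  "\<bar>sphere_ocs (Fin v) $ i $ j - sphere_ocs (Fin w) $ i $ j\<bar> \<le> 6 * (cmod (v - w) / sqrt (1 + (cmod v)\<^sup>2))"
proof -
  let ?N = "\<lambda>z :: complex. 1 + (cmod z)\<^sup>2" and ?e = "cmod (v - w) / sqrt (1 + (cmod v)\<^sup>2)"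
  have e: "?e \<ge> 0" by simp
  have "(1 - (cmod z)\<^sup>2) / ?N z = 2 * (1 / ?N z) - 1" for z
    using one_plus_norm_pos[of z] by (simp add: field_simps)
  then have a: "\<bar>(1 - (cmod v)\<^sup>2) / ?N v - (1 - (cmod w)\<^sup>2) / ?N w\<bar> \<le> 6 * ?e"
    using inverse_sphere_lipschitz(1)[of v w] e by (simp only:)
  let ?u = "v / of_real (?N v) - w / of_real (?N w)"
  have u: "\<bar>Re ?u\<bar> \<le> 3 * ?e" "\<bar>Im ?u\<bar> \<le> 3 * ?e"
    using inverse_sphere_lipschitz(2)[of v w] abs_Re_le_cmod[of ?u] abs_Im_le_cmod[of ?u] by linarith+
  have "Re ?u = Re v / ?N v - Re w / ?N w" "Im ?u = Im v / ?N v - Im w / ?N w"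
    unfolding minus_complex.sel Re_divide_of_real Im_divide_of_real by simp_all
  with u have b: "\<bar>2 * Re v / ?N v - 2 * Re w / ?N w\<bar> \<le> 6 * ?e"
    and c: "\<bar>2 * Im v / ?N v - 2 * Im w / ?N w\<bar> \<le> 6 * ?e"
    by (simp_all add: abs_le_iff)
  have neg: "\<bar>- x - - y\<bar> = \<bar>x - y\<bar>" for x y :: real by simp
  have "\<forall>i j. \<bar>sphere_ocs (Fin v) $ i $ j - sphere_ocs (Fin w) $ i $ j\<bar> \<le> 6 * ?e"
    unfolding forall_4 sphere_ocs_def P1.case Let_def skew4_def vector_4 neg
    using a b c e by simp
  then show ?thesis by blast
qed

lemma dist_warped_le:
  assumes \<sigma>: "\<sigma> = 1 \<or> \<sigma> = -1"
    and "\<And>i j. \<bar>sphere_ocs (f (part2 x)) $ i $ j - sphere_ocs (g (part2 x)) $ i $ j\<bar> \<le> e"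
  shows "dist (warped \<sigma> f x) (warped \<sigma> g x) \<le> 36 * e"
proof -
  have e: "e \<ge> 0" using assms(2) by (meson abs_ge_zero order_trans)
  have *: "\<bar>s * a * t - s * b * t\<bar> = \<bar>s\<bar> * \<bar>t\<bar> * \<bar>a - b\<bar>" for s t a b :: real
    by (simp flip: left_diff_distrib right_diff_distrib) (simp add: abs_mult)
  have "\<forall>i j. \<bar>(warped \<sigma> f x - warped \<sigma> g x) $ i $ j\<bar> \<le> e"
    unfolding Inl_Inr_exhaust using e assms
    by (auto simp: warped_def block_sum_def const_ocs_def reflect4_conj_nth * abs_if[of "- 1"])
  then show ?thesis unfolding dist_norm by (intro norm_matrix_le) blast
qed

section \<open>Embedding R^n by interpolation\<close>

lemma continuous_on_eval_bcontfun: "continuous_on S (\<lambda>T :: 'a::topological_space \<Rightarrow>\<^sub>C 'b::metric_space. T x)"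
  unfolding continuous_on_iff
proof (intro ballI allI impI)
  fix T :: "'a \<Rightarrow>\<^sub>C 'b" and e :: real
  assume "e > 0"
  then show "\<exists>d>0. \<forall>T'\<in>S. dist T' T < d \<longrightarrow> dist (T' x) (T x) < e"
    by (intro exI[of _ e]) (auto intro: le_less_trans[OF dist_bounded])
qed

text \<open>Stereographic projection \<open>b / (1 + a)\<close> inverts the parametrization by the
  sphere, and for a real parameter two entries suffice. The denominator is nonzero because the point
  is finite.\<close>

lemma sphere_ocs_of_real:
  "sphere_ocs (Fin (of_real c)) $ 2 $ 3 / (1 + sphere_ocs (Fin (of_real c)) $ 2 $ 1) = c"
  "1 + sphere_ocs (Fin (of_real c)) $ 2 $ 1 \<noteq> 0"
proof -
  have pos: "1 + c\<^sup>2 > 0" by (simp add: add_pos_nonneg)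
  then have 1: "1 + sphere_ocs (Fin (of_real c)) $ 2 $ 1 = 2 / (1 + c\<^sup>2)"
    by (simp add: sphere_ocs_def Let_def skew4_def field_simps)
  have 2: "sphere_ocs (Fin (of_real c)) $ 2 $ 3 = 2 * c / (1 + c\<^sup>2)"
    by (simp add: sphere_ocs_def Let_def skew4_def)
  show "sphere_ocs (Fin (of_real c)) $ 2 $ 3 / (1 + sphere_ocs (Fin (of_real c)) $ 2 $ 1) = c"
    "1 + sphere_ocs (Fin (of_real c)) $ 2 $ 1 \<noteq> 0"
    unfolding 1 2 using pos by simp_all
qed

lemma infinite_dimensional_warped:
  assumes L: "is_lattice L" and \<sigma>: "\<sigma> = 1 \<or> \<sigma> = -1"
  shows "infinite_dimensional (uniform_topology (warped \<sigma> ` elliptic_to_P1 L))"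
  unfolding infinite_dimensional_def
proof
  fix n :: nat
  obtain z where z: "\<And>j. j < n \<Longrightarrow> z j \<notin> L" "inj_on (\<lambda>j. eisenstein L (z j)) {..<n}"
    by (rule eisenstein_nodes[OF L, where n = n]) blast
  define a where "a j = eisenstein L (z j)" for j
  define f where "f c = interpol_elliptic L n a c" for c
  define h where "h c = Bcontfun (warped \<sigma> (f c))" for c
  have h: "apply_bcontfun (h c) = warped \<sigma> (f c)" for c
    unfolding h_def f_def by (rule Bcontfun_inverse[OF warped_bcontfun[OF interpol_elliptic[OF L] \<sigma>]])
  \<comment> \<open>\<open>Euclidean_space n\<close> consists of the sequences vanishing from index
    \<open>n\<close> on, with the product topology.\<close>
  define E :: "(nat \<Rightarrow> real) set" where "E = {x. \<forall>i\<ge>n. x i = 0}"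
  have E: "Euclidean_space n = top_of_set E"
    by (simp add: Euclidean_space_def E_def euclidean_product_topology)
  \<comment> \<open>\<open>C\<close> depends on \<open>c\<close> through
    \<open>lagrange_bound\<close>, which is enough for continuity at \<open>c\<close>. On
    \<open>L\<close> both functions take the value \<open>Infty\<close>, so only the complement
    needs an estimate.\<close>
  have lip: "\<exists>C. \<forall>c'. dist (h c') (h c) \<le> C * (\<Sum>j<n. \<bar>c' j - c j\<bar>)" for c
  proof -
    obtain M where M: "M \<ge> 0" "\<And>w j. j < n \<Longrightarrow> cmod (lagrange n a j w) \<le> M * sqrt (1 + (cmod (interpol n a c w))\<^sup>2)"
      by (rule lagrange_bound[where n = n and a = a and c = c]) blast
    have "dist (h c) (h c') \<le> 36 * (6 * M) * (\<Sum>j<n. \<bar>c' j - c j\<bar>)" for c'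
    proof (rule dist_bound)
      fix x
      let ?d = "\<Sum>j<n. \<bar>c' j - c j\<bar>"
      have d: "?d \<ge> 0" by (simp add: sum_nonneg)
      have "\<bar>sphere_ocs (f c (part2 x)) $ i $ j - sphere_ocs (f c' (part2 x)) $ i $ j\<bar> \<le> 6 * M * ?d" for i j
      proof (cases "part2 x \<in> L")
        case True
        then show ?thesis using M(1) d by (simp add: f_def interpol_elliptic_def)
      next
        case False
        let ?w = "eisenstein L (part2 x)"
        let ?p = "interpol n a c ?w" and ?q = "interpol n a c' ?w"
        have "?p - ?q = (\<Sum>j<n. of_real (c j - c' j) * lagrange n a j ?w)"
          by (simp add: interpol_def sum_subtractf left_diff_distrib)
        then have "cmod (?p - ?q) \<le> (\<Sum>j<n. cmod (of_real (c j - c' j) * lagrange n a j ?w))"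
          by (simp only: norm_sum)
        also have "\<dots> = (\<Sum>j<n. \<bar>c' j - c j\<bar> * cmod (lagrange n a j ?w))"
          by (simp only: norm_mult norm_of_real abs_minus_commute)
        also have "\<dots> \<le> (\<Sum>j<n. \<bar>c' j - c j\<bar> * (M * sqrt (1 + (cmod ?p)\<^sup>2)))"
          using M(2) by (intro sum_mono mult_left_mono) auto
        also have "\<dots> = M * ?d * sqrt (1 + (cmod ?p)\<^sup>2)"
          by (simp add: sum_distrib_left sum_distrib_right mult_ac)
        finally have "cmod (?p - ?q) / sqrt (1 + (cmod ?p)\<^sup>2) \<le> M * ?d"
          using one_plus_norm_pos[of ?p] by (simp add: divide_le_eq)
        then show ?thesis
          using sphere_ocs_lipschitz[of ?p i j ?q] False by (simp add: f_def interpol_elliptic_def)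
      qed
      then show "dist (h c x) (h c' x) \<le> 36 * (6 * M) * ?d"
        unfolding h using dist_warped_le[OF \<sigma>, of "f c" x "f c'" "6 * M * ?d"] by (simp add: mult.assoc)
    qed
    then show ?thesis by (intro exI[of _ "36 * (6 * M)"]) (simp add: dist_commute)
  qed
  have cont_h: "continuous_on E h"
    unfolding continuous_on_def
  proof
    fix c assume "c \<in> E"
    obtain C where C: "\<And>c'. dist (h c') (h c) \<le> C * (\<Sum>j<n. \<bar>c' j - c j\<bar>)" using lip by blast
    have coord: "((\<lambda>c'. c' j) \<longlongrightarrow> c j) (at c within E)" for j
      using continuous_on_subset[OF continuous_on_product_coordinates[of j] subset_UNIV] \<open>c \<in> E\<close>
      unfolding continuous_on_def by blast
    have "((\<lambda>c'. C * (\<Sum>j<n. \<bar>c' j - c j\<bar>)) \<longlongrightarrow> C * (\<Sum>j<n. \<bar>c j - c j\<bar>)) (at c within E)"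
      by (intro tendsto_intros coord)
    then have "((\<lambda>c'. C * (\<Sum>j<n. \<bar>c' j - c j\<bar>)) \<longlongrightarrow> 0) (at c within E)" by simp
    then have "((\<lambda>c'. dist (h c') (h c)) \<longlongrightarrow> 0) (at c within E)"
      by (rule tendsto_sandwich[OF _ _ tendsto_const, rotated 2]) (use C in auto)
    then show "(h \<longlongrightarrow> h c) (at c within E)" by (rule tendsto_dist_iff[THEN iffD2])
  qed
  define x :: "nat \<Rightarrow> R6" where "x j = vec6 1 0 0 (z j)" for j
  \<comment> \<open>A continuous left inverse of \<open>h\<close> on its image: it evaluates a
    structure over the points \<open>z j\<close> and reads off the parameters by
    \<open>sphere_ocs_of_real\<close>.\<close>
  define g :: "(R6 \<Rightarrow>\<^sub>C (real ^ (4 + 2) ^ (4 + 2))) \<Rightarrow> nat \<Rightarrow> real" where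
    "g T j = (if j < n then T (x j) $ Inl 2 $ Inl 3 / (1 + T (x j) $ Inl 2 $ Inl 1) else 0)" for T j
  \<comment> \<open>Conjugation by \<open>reflect4 \<sigma>\<close> leaves entries outside row and
    column 4 unchanged, so the recovery of \<open>c\<close> is the same for both
    orientations.\<close>
  have entry: "h c (x j) $ Inl 2 $ Inl k = sphere_ocs (Fin (of_real (c j))) $ 2 $ k" if "j < n" "k \<noteq> 4" for c j k
  proof -
    have "f c (z j) = Fin (of_real (c j))"
      using interpol_node[of a n j c] z that by (simp add: f_def interpol_elliptic_def a_def[abs_def])
    then show ?thesis
      using that by (simp add: h warped_def block_sum_def const_ocs_def reflect4_conj_nth x_def coordinates_vec6)
  qed
  have gh: "g (h c) = c" if "c \<in> E" for c
    using that by (auto simp: fun_eq_iff g_def entry sphere_ocs_of_real E_def)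
  have cont_g: "continuous_on (h ` E) g"
  proof (rule continuous_on_coordinatewise_then_product)
    fix j
    show "continuous_on (h ` E) (\<lambda>T. g T j)"
    proof (cases "j < n")
      case True
      have "1 + T (x j) $ Inl 2 $ Inl 1 \<noteq> 0" if "T \<in> h ` E" for T
        using that True entry[OF True, of 1] sphere_ocs_of_real(2) by auto
      then show ?thesis
        using True by (auto simp: g_def intro!: continuous_intros continuous_on_eval_bcontfun)
    qed (simp add: g_def)
  qed
  have sub: "h ` E \<subseteq> {T. apply_bcontfun T \<in> warped \<sigma> ` elliptic_to_P1 L}"
    using h interpol_elliptic[OF L] by (auto simp: f_def)
  have "homeomorphic_maps (top_of_set E) (top_of_set (h ` E)) h g"
    unfolding homeomorphic_maps_def
    using cont_h cont_g gh by (auto simp: image_iff)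
  then have "homeomorphic_map (top_of_set E) (top_of_set (h ` E)) h"
    unfolding homeomorphic_map_maps by blast
  then have "embedding_map (Euclidean_space n) (uniform_topology (warped \<sigma> ` elliptic_to_P1 L)) h"
    unfolding embedding_map_def E uniform_topology_def using sub
    by (simp add: subtopology_subtopology inf.absorb2)
  then show "\<exists>h. embedding_map (Euclidean_space n) (uniform_topology (warped \<sigma> ` elliptic_to_P1 L)) h"
    by (intro exI[of _ h])
qed

theorem theorem1p3:
  fixes L4 :: "(real ^ 4) set" and L2 :: "complex set" and \<sigma> :: real
  assumes "is_lattice L4" and "is_lattice L2" and "\<sigma> = 1 \<or> \<sigma> = -1"
  shows "warped \<sigma> ` elliptic_to_P1 L2 \<subseteq> {J. torus_ocs (product_lattice L4 L2) J} \<and>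
    infinite_dimensional (uniform_topology (warped \<sigma> ` elliptic_to_P1 L2)) \<and>
    (\<forall>f \<in> elliptic_to_P1 L2. \<not> f constant_on UNIV \<longrightarrow> energy (warped \<sigma> f) = \<infinity>)"
proof (intro conjI ballI impI)
  show "warped \<sigma> ` elliptic_to_P1 L2 \<subseteq> {J. torus_ocs (product_lattice L4 L2) J}"
    using torus_ocs_warped assms(3) by blast
  show "infinite_dimensional (uniform_topology (warped \<sigma> ` elliptic_to_P1 L2))"
    using assms(2,3) by (rule infinite_dimensional_warped)
  show "energy (warped \<sigma> f) = \<infinity>" if "f \<in> elliptic_to_P1 L2" "\<not> f constant_on UNIV" for f
    using that assms(3) by (intro energy_warped) (auto simp: elliptic_to_P1_def)
qed

end
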